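(* Let $A\in\mathbb{R}^{k\times n}$, $y\in\mathbb{R}^k$, $\delta\ge 0$, and consider the constrained basis pursuit denoising (CBPDN) problem $$\min_{x\in\mathbb{R}^n}\ \|x\|_1\quad\text{subject to } \|Ax-y\|_2\le\delta,\ x\ge 0$$ (for $\delta=0$ this is the constrained basis pursuit problem: minimize $\|x\|_1$ subject to $Ax=y$, $x\ge 0$), written equivalently as $$\min_{x}\ \|x\|_1+\iota_{B(y,\delta)}(Ax)+\iota_{\mathbb{R}^n_+}(x).$$ The objective function of the latter form is proper, convex, lower semi-continuous, and coercive, and thus has a non-empty set of minimizers. Let $\lambda\ge 0$ and set $f_1(x)=0$ for $x\in\mathbb{R}^n$, $f_2(u)=\iota_{B(y,\delta)}(u_1)+\lambda\|u_2\|_1+\iota_{\mathbb{R}^n_+}(u_2)$ for $u=[u_1^T\ u_2^T]^T$ with $u_1\in\mathbb{R}^k$, $u_2\in\mathbb{R}^n$, and $G=[A^T\ I]^T$. Then $f_1$ and $f_2$ are closed and $G$ has full column rank. Consequently the C-SUnSAL algorithm, which is the alternating direction method of multipliers applied with these $f_1,f_2,G$, converges: for any $\mu>0$ and arbitrary $u_{1,0},d_{1,0}\in\mathbb{R}^k$ and $u_{2,0},d_{2,0}\in\mathbb{R}^n$, if sequences are generated, for $j=0,1,2,\dots$, by $$x_{j+1}=(A^TA+I)^{-1}\bigl(A^T(u_{1,j}+d_{1,j})+u_{2,j}+d_{2,j}\bigr),$$ $$u_{1,j+1}=\psi_{B(y,\delta)}(Ax_{j+1}-d_{1,j}),$$ $$u_{2,j+1}=\max\{0,\operatorname{soft}(x_{j+1}-d_{2,j},\lambda/\mu)\},$$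 $$d_{1,j+1}=d_{1,j}-(Ax_{j+1}-u_{1,j+1}),$$ $$d_{2,j+1}=d_{2,j}-(x_{j+1}-u_{2,j+1}),$$ then $\{x_j\}$ converges to a solution of the CBPDN problem.
   Context: For a set $S$, $\iota_S$ is its indicator function: $\iota_S(x)=0$ if $x\in S$ and $\iota_S(x)=\infty$ if $x\notin S$. $\mathbb{R}^n_+$ is the set of vectors with non-negative components; the inequality $x\ge 0$ and the maximum with $0$ are componentwise. The soft threshold with parameter $\tau\ge 0$ acts componentwise on a vector $v$ by $\operatorname{soft}(v,\tau)_i=\operatorname{sign}(v_i)\max\{|v_i|-\tau,0\}$. $B(y,\delta)=\{z\in\mathbb{R}^k:\|z-y\|_2\le\delta\}$ is the closed ball of radius $\delta$ around $y$, and $\psi_{B(y,\delta)}$ is the projection onto it: $\psi_{B(y,\delta)}(v)=v$ if $\|v-y\|_2\le\delta$, and $\psi_{B(y,\delta)}(v)=y+\delta\,\frac{v-y}{\|v-y\|_2}$ otherwise. $\|\cdot\|_2$ and $\|\cdot\|_1$ are the $\ell_2$ and $\ell_1$ norms, and $I$ is the identity matrix. The alternating direction method of multipliers for $\min_x f_1(x)+f_2(Gx)$ iterates $x_{j+1}\in\arg\min_x f_1(x)+\frac{\mu}{2}\|Gx-u_j-d_j\|_2^2$, $u_{j+1}\in\arg\min_u f_2(u)+\frac{\mu}{2}\|Gx_{j+1}-u-d_j\|_2^2$, $d_{j+1}=d_j-(Gx_{j+1}-u_{j+1})$; here $u_j=[u_{1,j}^T\ u_{2,j}^T]^T$ and $d_j=[d_{1,j}^T\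 d_{2,j}^T]^T$.
   Formalization: The CBPDN problem is assumed feasible (otherwise the objective is identically infinite and not proper); for λ=0 the sequence x_j is shown to converge to a minimizer of f_1+f_2∘G, and the limit is claimed to solve CBPDN only for λ>0, since for λ=0 that fails. *)

theory Defs
  imports "HOL-Analysis.Analysis"
begin

section \<open>Extended-real-valued convex analysis\<close>

definition ind_fun :: "'a set \<Rightarrow> 'a \<Rightarrow> ereal" where
  "ind_fun S x = (if x \<in> S then 0 else \<infinity>)"

definition proper_fun :: "('a \<Rightarrow> ereal) \<Rightarrow> bool" where
  "proper_fun f \<longleftrightarrow> (\<forall>x. f x \<noteq> -\<infinity>) \<and> (\<exists>x. f x \<noteq> \<infinity>)"

text \<open>Convexity of the epigraph; this form also makes sense when a function takes both values
  \<open>\<infinity>\<close> and \<open>-\<infinity>\<close>.\<close>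

definition convex_fun :: "('a::real_vector \<Rightarrow> ereal) \<Rightarrow> bool" where
  "convex_fun f \<longleftrightarrow> convex {(x, r::real). f x \<le> ereal r}"

definition closed_fun :: "('a::topological_space \<Rightarrow> ereal) \<Rightarrow> bool" where
  "closed_fun f \<longleftrightarrow> closed {(x, r::real). f x \<le> ereal r}"

definition lsc_fun :: "('a::topological_space \<Rightarrow> ereal) \<Rightarrow> bool" where
  "lsc_fun f \<longleftrightarrow> (\<forall>x. f x \<le> Liminf (at x) f)"

definition coercive_fun :: "('a::real_normed_vector \<Rightarrow> ereal) \<Rightarrow> bool" where
  "coercive_fun f \<longleftrightarrow> (f \<longlongrightarrow> \<infinity>) at_infinity"

abbreviation minimizer :: "('a \<Rightarrow> ereal) \<Rightarrow> 'a \<Rightarrow> bool" where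
  "minimizer f x \<equiv> is_arg_min f (\<lambda>_. True) x"


section \<open>Vectors\<close>

definition l1_norm :: "real^'n \<Rightarrow> real" where
  "l1_norm x = (\<Sum>i\<in>UNIV. \<bar>x $ i\<bar>)"

definition nonneg_orthant :: "(real^'n) set" where
  "nonneg_orthant = {x. \<forall>i. 0 \<le> x $ i}"

definition soft :: "real^'n \<Rightarrow> real \<Rightarrow> real^'n" where
  "soft v \<tau> = (\<chi> i. sgn (v $ i) * max (\<bar>v $ i\<bar> - \<tau>) 0)"

definition pos_part :: "real^'n \<Rightarrow> real^'n" where
  "pos_part v = (\<chi> i. max 0 (v $ i))"

definition ball_proj :: "real^'k \<Rightarrow> real \<Rightarrow> real^'k \<Rightarrow> real^'k" where
  "ball_proj y \<delta> v =
     (if norm (v - y) \<le> \<delta> then v else y + (\<delta> / norm (v - y)) *\<^sub>R (v - y))"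

text \<open>Vertical stacking. The entries may themselves be row vectors, so the same operation
  stacks two column vectors and two matrices. A stacked vector carries the Euclidean norm.\<close>

definition stack :: "'a^'k \<Rightarrow> 'a^'n \<Rightarrow> 'a^('k + 'n)" where
  "stack u v = (\<chi> i. case i of Inl a \<Rightarrow> u $ a | Inr b \<Rightarrow> v $ b)"

definition upper :: "'a^('k::finite + 'n::finite) \<Rightarrow> 'a^'k" where
  "upper u = (\<chi> a. u $ Inl a)"

definition lower :: "'a^('k::finite + 'n::finite) \<Rightarrow> 'a^'n" where
  "lower u = (\<chi> b. u $ Inr b)"


section \<open>The alternating direction method of multipliers\<close>

text \<open>The sequences are generated by the method for minimizing \<open>f1 x + f2 (G x)\<close>, started
  at \<open>u 0\<close> and \<open>d 0\<close>; the value \<open>x 0\<close> plays no role.\<close>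

definition admm ::
  "real \<Rightarrow> (real^'n \<Rightarrow> ereal) \<Rightarrow> (real^'m \<Rightarrow> ereal) \<Rightarrow> real^'n^'m
    \<Rightarrow> (nat \<Rightarrow> real^'n) \<Rightarrow> (nat \<Rightarrow> real^'m) \<Rightarrow> (nat \<Rightarrow> real^'m) \<Rightarrow> bool" where
  "admm \<mu> f1 f2 G x u d \<longleftrightarrow>
     (\<forall>j. minimizer (\<lambda>z. f1 z + ereal (\<mu> / 2 * (norm (G *v z - u j - d j))\<^sup>2)) (x (Suc j))
        \<and> minimizer (\<lambda>w. f2 w + ereal (\<mu> / 2 * (norm (G *v x (Suc j) - w - d j))\<^sup>2)) (u (Suc j))
        \<and> d (Suc j) = d j - (G *v x (Suc j) - u (Suc j)))"


section \<open>Constrained basis pursuit denoising and C-SUnSAL\<close>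

definition cbpdn_feasible :: "real^'n^'k \<Rightarrow> real^'k \<Rightarrow> real \<Rightarrow> real^'n \<Rightarrow> bool" where
  "cbpdn_feasible A y \<delta> x \<longleftrightarrow> norm (A *v x - y) \<le> \<delta> \<and> x \<in> nonneg_orthant"

definition cbpdn_solution :: "real^'n^'k \<Rightarrow> real^'k \<Rightarrow> real \<Rightarrow> real^'n \<Rightarrow> bool" where
  "cbpdn_solution A y \<delta> x \<longleftrightarrow> is_arg_min l1_norm (cbpdn_feasible A y \<delta>) x"

definition cbpdn_objective :: "real^'n^'k \<Rightarrow> real^'k \<Rightarrow> real \<Rightarrow> real^'n \<Rightarrow> ereal" where
  "cbpdn_objective A y \<delta> x =
     ereal (l1_norm x) + ind_fun (cball y \<delta>) (A *v x) + ind_fun nonneg_orthant x"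

definition csunsal_f1 :: "real^'n \<Rightarrow> ereal" where
  "csunsal_f1 x = 0"

definition csunsal_f2 :: "real^'k \<Rightarrow> real \<Rightarrow> real \<Rightarrow> real^('k::finite + 'n::finite) \<Rightarrow> ereal" where
  "csunsal_f2 y \<delta> lam u =
     ind_fun (cball y \<delta>) (upper u) + ereal (lam * l1_norm (lower u))
       + ind_fun nonneg_orthant (lower u)"

definition csunsal_G :: "real^'n^'k \<Rightarrow> real^'n^('k + 'n)" where
  "csunsal_G A = stack A (mat 1)"

definition csunsal ::
  "real^'n^'k \<Rightarrow> real^'k \<Rightarrow> real \<Rightarrow> real \<Rightarrow> real
    \<Rightarrow> (nat \<Rightarrow> real^'n) \<Rightarrow> (nat \<Rightarrow> real^'k) \<Rightarrow> (nat \<Rightarrow> real^'n)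
    \<Rightarrow> (nat \<Rightarrow> real^'k) \<Rightarrow> (nat \<Rightarrow> real^'n) \<Rightarrow> bool" where
  "csunsal A y \<delta> lam \<mu> x u1 u2 d1 d2 \<longleftrightarrow>
     (\<forall>j. x (Suc j) = matrix_inv (transpose A ** A + mat 1)
                         *v (transpose A *v (u1 j + d1 j) + u2 j + d2 j)
        \<and> u1 (Suc j) = ball_proj y \<delta> (A *v x (Suc j) - d1 j)
        \<and> u2 (Suc j) = pos_part (soft (x (Suc j) - d2 j) (lam / \<mu>))
        \<and> d1 (Suc j) = d1 j - (A *v x (Suc j) - u1 (Suc j))
        \<and> d2 (Suc j) = d2 j - (x (Suc j) - u2 (Suc j)))"

end

(* With S j = G x_(j+1) - d_j the method is the Douglas-Rachford iteration for f2 and the range of G,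
   whose operator T is firmly nonexpansive. The penalty problems
   min tau |x|_1 + t/2 |A x - p|^2 over x >= 0 and p in the ball provide points that T moves
   arbitrarily little, so S j - S (j+1) tends to 0 even when T has no fixed point.

   If some x >= 0 lies strictly inside the ball constraint, or if tau = 0, then S is bounded and
   converges to a fixed point, which encodes a primal-dual solution. Otherwise a dual solution need
   not exist and S may diverge. All feasible points then have the same image under A, and the
   problem becomes a linear program over x >= 0. Since r j - tau 1 - A^T g j tends to 0, where r j >= 0
   is complementary to the nonnegative iterate, pairing with directions in the kernel of A shows
   that the iterates are bounded and that their limit points solve the linear program, although the
   multipliers g j may be unbounded. The iterates move along the optimal face only through the
   multipliers r j at the walls they touch, always towards a relative interior point of the face,
   so the total movement is finite and the limit point is unique. *)

theory Submission
  imports Defs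
begin

section \<open>Orbits of firmly nonexpansive maps\<close>

definition firmly_nonexpansive :: "('a::real_inner \<Rightarrow> 'a) \<Rightarrow> bool" where
  "firmly_nonexpansive T \<longleftrightarrow>
     (\<forall>s t. (norm (T s - T t))\<^sup>2 + (norm ((s - T s) - (t - T t)))\<^sup>2 \<le> (norm (s - t))\<^sup>2)"

lemma firmly_nonexpansiveD:
  "firmly_nonexpansive T \<Longrightarrow>
    (norm (T s - T t))\<^sup>2 + (norm ((s - T s) - (t - T t)))\<^sup>2 \<le> (norm (s - t))\<^sup>2"
  unfolding firmly_nonexpansive_def by blast

lemma firmly_nonexpansive_imp_nonexpansive:
  assumes "firmly_nonexpansive T"
  shows "norm (T s - T t) \<le> norm (s - t)"
proof (rule power2_le_imp_le)
  show "(norm (T s - T t))\<^sup>2 \<le> (norm (s - t))\<^sup>2"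
    using firmly_nonexpansiveD[OF assms, of s t] zero_le_power2[of "norm ((s - T s) - (t - T t))"]
    by linarith
qed simp

text \<open>The orbit is compared with that of an almost fixed point \<open>t\<close>. Firm
  nonexpansiveness makes the squared differences of the two displacement sequences summable, and
  nonexpansiveness keeps the displacements of the comparison orbit small. This works even if
  \<open>T\<close> has no fixed point.\<close>

lemma firmly_nonexpansive_asymptotically_regular:
  assumes T: "firmly_nonexpansive T"
    and approx: "\<And>e. e > 0 \<Longrightarrow> \<exists>t. norm (t - T t) \<le> e"
    and orbit: "\<And>j. S (Suc j) = T (S j)"
  shows "(\<lambda>j. S j - S (Suc j)) \<longlonglongrightarrow> 0"
proof (rule LIMSEQ_I)
  fix e :: real assume "e > 0"
  then obtain t where t: "norm (t - T t) \<le> e / 2"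
    using approx[of "e / 2"] by auto
  define R where "R j = (T ^^ j) t" for j
  define D where "D j = (S j - S (Suc j)) - (R j - R (Suc j))" for j
  have R: "R (Suc j) = T (R j)" for j by (simp add: R_def)
  have R_step: "norm (R j - R (Suc j)) \<le> e / 2" for j
  proof (induction j)
    case 0 then show ?case using t by (simp add: R_def)
  next
    case (Suc j)
    then show ?case
      using firmly_nonexpansive_imp_nonexpansive[OF T, of "R j" "R (Suc j)"] by (simp add: R)
  qed
  have descent: "(norm (D j))\<^sup>2 \<le> (norm (S j - R j))\<^sup>2 - (norm (S (Suc j) - R (Suc j)))\<^sup>2" for j
    using firmly_nonexpansiveD[OF T, of "S j" "R j"] by (simp add: D_def R orbit)
  have "(\<Sum>j<n. (norm (D j))\<^sup>2) \<le> (norm (S 0 - R 0))\<^sup>2 - (norm (S n - R n))\<^sup>2" for n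
  proof (induction n)
    case (Suc n) then show ?case using descent[of n] by simp
  qed simp
  then have "(\<Sum>j<n. (norm (D j))\<^sup>2) \<le> (norm (S 0 - R 0))\<^sup>2" for n
    by (smt (verit) zero_le_power2)
  then have "summable (\<lambda>j. (norm (D j))\<^sup>2)"
    by (intro summableI_nonneg_bounded) auto
  then have "(\<lambda>j. (norm (D j))\<^sup>2) \<longlonglongrightarrow> 0"
    by (rule summable_LIMSEQ_zero)
  then have "D \<longlonglongrightarrow> 0"
    by (simp add: tendsto_norm_zero_iff)
  then obtain N where N: "\<And>j. j \<ge> N \<Longrightarrow> norm (D j) < e / 2"
    using \<open>e > 0\<close> LIMSEQ_D[of D 0 "e / 2"] by auto
  have "norm (S j - S (Suc j)) < e" if "j \<ge> N" for j
  proof -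
    have "norm (S j - S (Suc j)) \<le> norm (D j) + norm (R j - R (Suc j))"
      using norm_triangle_ineq[of "D j" "R j - R (Suc j)"] by (simp add: D_def)
    then show ?thesis using N[OF that] R_step[of j] by linarith
  qed
  then show "\<exists>N. \<forall>j\<ge>N. norm (S j - S (Suc j) - 0) < e" by auto
qed

text \<open>Asymptotic regularity makes a limit point of the orbit a fixed point. Distances to a
  fixed point decrease along the orbit, so their limit can be read off the convergent subsequence
  and is zero.\<close>

lemma firmly_nonexpansive_bounded_orbit_converges:
  fixes S :: "nat \<Rightarrow> 'a::euclidean_space"
  assumes T: "firmly_nonexpansive T"
    and orbit: "\<And>j. S (Suc j) = T (S j)"
    and regular: "(\<lambda>j. S j - S (Suc j)) \<longlonglongrightarrow> 0"
    and bdd: "bounded (range S)"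
  shows "\<exists>f. T f = f \<and> S \<longlonglongrightarrow> f"
proof -
  obtain f r where r: "strict_mono r" and lim: "(S \<circ> r) \<longlonglongrightarrow> f"
    using bounded_imp_convergent_subsequence[OF bdd] by auto
  note nonexp = firmly_nonexpansive_imp_nonexpansive[OF T]
  have lim0: "(\<lambda>i. norm (S (r i) - f)) \<longlonglongrightarrow> 0"
    using lim by (simp add: o_def LIM_zero_iff tendsto_norm_zero_iff)
  have reg_r: "(\<lambda>i. norm (S (r i) - S (Suc (r i)))) \<longlonglongrightarrow> 0"
    using LIMSEQ_subseq_LIMSEQ[OF regular r] by (simp add: o_def tendsto_norm_zero_iff)
  have "norm (f - T f) \<le> 2 * norm (S (r i) - f) + norm (S (r i) - S (Suc (r i)))" for i
  proof -
    have "norm (f - T f) \<le> norm (f - S (r i)) + norm (S (r i) - S (Suc (r i)))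
        + norm (S (Suc (r i)) - T f)"
      by norm
    then show ?thesis
      using nonexp[of "S (r i)" f] by (simp add: orbit norm_minus_commute)
  qed
  moreover have "(\<lambda>i. 2 * norm (S (r i) - f) + norm (S (r i) - S (Suc (r i)))) \<longlonglongrightarrow> 2 * 0 + 0"
    by (intro tendsto_intros lim0 reg_r)
  ultimately have "norm (f - T f) \<le> 0"
    by (intro LIMSEQ_le_const[of _ "2 * 0 + 0 :: real", simplified]) auto
  then have fix_f: "T f = f" by simp
  have "decseq (\<lambda>j. norm (S j - f))"
    using nonexp[of _ f] by (intro decseq_SucI) (simp add: orbit fix_f)
  then have "convergent (\<lambda>j. norm (S j - f))"
    by (intro Bseq_monoseq_convergent decseq_imp_monoseq
         Bseq_eq_bounded decseq_bounded[of _ 0]) auto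
  then obtain L where L: "(\<lambda>j. norm (S j - f)) \<longlonglongrightarrow> L" by (auto simp: convergent_def)
  have "L = 0"
    using LIMSEQ_unique[OF LIMSEQ_subseq_LIMSEQ[OF L r, unfolded o_def] lim0] .
  then have "S \<longlonglongrightarrow> f"
    using L by (simp add: LIM_zero_iff tendsto_norm_zero_iff)
  with fix_f show ?thesis by blast
qed

section \<open>The Douglas-Rachford operator\<close>

lemma inner_matrix_vector_mul:
  fixes A :: "real^'n^'k"
  shows "(A *v x) \<bullet> z = x \<bullet> (transpose A *v z)"
  by (metis dot_lmul_matrix inner_commute vector_transpose_matrix)

lemma l1_norm_nonneg: "0 \<le> l1_norm x"
  by (simp add: l1_norm_def sum_nonneg)

lemma l1_norm_orthant: "x \<in> nonneg_orthant \<Longrightarrow> l1_norm x = 1 \<bullet> x"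
  by (simp add: l1_norm_def nonneg_orthant_def inner_vec_def)

lemma norm_le_l1_norm: "norm x \<le> l1_norm x"
  unfolding l1_norm_def by (rule norm_le_l1_cart)

lemma convex_nonneg_orthant: "convex nonneg_orthant"
  by (auto simp: convex_def nonneg_orthant_def)

lemma closed_nonneg_orthant: "closed nonneg_orthant"
proof -
  have "nonneg_orthant = (\<Inter>i. {x :: real^'n. 0 \<le> x $ i})" by (auto simp: nonneg_orthant_def)
  also have "closed \<dots>" by (intro closed_INT ballI closed_Collect_le continuous_intros)
  finally show ?thesis .
qed

lemma ball_proj_in_cball: "\<delta> \<ge> 0 \<Longrightarrow> ball_proj y \<delta> v \<in> cball y \<delta>"
  by (auto simp: ball_proj_def dist_norm norm_minus_commute)

text \<open>For \<open>v\<close> outside the ball the formula attains the lower bound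
  \<open>norm (v - y) - \<delta>\<close> that the triangle inequality sets for distances to the
  ball. It is therefore a closest point, and closest points of convex sets satisfy the obtuse angle
  condition.\<close>

lemma ball_proj_variational:
  assumes "\<delta> \<ge> 0" "z \<in> cball y \<delta>"
  shows "(v - ball_proj y \<delta> v) \<bullet> (z - ball_proj y \<delta> v) \<le> 0"
proof (rule any_closest_point_dot[of "cball y \<delta>"])
  show "\<forall>z\<in>cball y \<delta>. dist v (ball_proj y \<delta> v) \<le> dist v z"
  proof
    fix z assume z: "z \<in> cball y \<delta>"
    show "dist v (ball_proj y \<delta> v) \<le> dist v z"
    proof (cases "norm (v - y) \<le> \<delta>")
      case False
      then have pos: "norm (v - y) > 0" using assms(1) by linarith
      have "v - ball_proj y \<delta> v = (1 - \<delta> / norm (v - y)) *\<^sub>R (v - y)"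
        using False by (simp add: ball_proj_def algebra_simps)
      then have "dist v (ball_proj y \<delta> v) = \<bar>1 - \<delta> / norm (v - y)\<bar> * norm (v - y)"
        by (simp only: dist_norm norm_scaleR)
      also have "\<dots> = norm (v - y) - \<delta>"
        using False pos by (simp add: abs_of_nonneg algebra_simps)
      also have "\<dots> \<le> dist v z"
        using z dist_triangle[of v y z] by (simp add: dist_norm norm_minus_commute)
      finally show ?thesis .
    qed (simp add: ball_proj_def)
  qed
qed (use assms ball_proj_in_cball in auto)

text \<open>The variational inequalities at \<open>p\<close> and at the projection, each tested at
  the other point, add up to a squared distance that is at most zero.\<close>

lemma ball_proj_unique:
  assumes "\<delta> \<ge> 0" "p \<in> cball y \<delta>" "\<And>z. z \<in> cball y \<delta> \<Longrightarrow> (v - p) \<bullet> (z - p) \<le> 0"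
  shows "ball_proj y \<delta> v = p"
proof -
  let ?b = "ball_proj y \<delta> v"
  have "(v - p) \<bullet> (?b - p) \<le> 0" using assms ball_proj_in_cball by blast
  moreover have "(v - ?b) \<bullet> (p - ?b) \<le> 0" using assms ball_proj_variational by blast
  ultimately have "(p - ?b) \<bullet> (p - ?b) \<le> 0" by (simp add: inner_simps inner_commute)
  then show ?thesis by (metis eq_iff_diff_eq_0 inner_eq_zero_iff inner_ge_zero order_antisym)
qed

lemma pos_part_soft:
  "\<tau> \<ge> 0 \<Longrightarrow> pos_part (soft v \<tau>) = (\<chi> i. max 0 (v $ i - \<tau>))"
  by (simp add: vec_eq_iff pos_part_def soft_def sgn_if max_def)

lemma pos_part_in_orthant: "pos_part v \<in> nonneg_orthant"
  by (simp add: pos_part_def nonneg_orthant_def)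

lemma inner_nonneg_orthant:
  "x \<in> nonneg_orthant \<Longrightarrow> z \<in> nonneg_orthant \<Longrightarrow> 0 \<le> x \<bullet> z"
  by (auto simp: nonneg_orthant_def inner_vec_def intro!: sum_nonneg)

text \<open>This is the optimality condition of the proximal step for \<tau> times the l1 norm on
  the orthant, where that norm is the linear functional \<open>1 \<bullet> x\<close>. It holds
  coordinate by coordinate.\<close>

lemma pos_part_soft_variational:
  assumes "\<tau> \<ge> 0" "z \<in> nonneg_orthant"
  shows "(v - pos_part (soft v \<tau>)) \<bullet> (z - pos_part (soft v \<tau>)) \<le> \<tau> * (1 \<bullet> (z - pos_part (soft v \<tau>)))"
proof -
  have "(v $ i - max 0 (v $ i - \<tau>)) * (z $ i - max 0 (v $ i - \<tau>)) \<le> \<tau> * (z $ i - max 0 (v $ i - \<tau>))" for i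
    using assms mult_right_mono[of "v $ i" \<tau> "z $ i"] by (auto simp: max_def nonneg_orthant_def)
  then show ?thesis
    by (simp add: pos_part_soft[OF assms(1)] inner_vec_def sum_distrib_left sum_mono)
qed

section \<open>The graph projection and the Douglas-Rachford step\<close>

definition normal_solve :: "real^'n^'k \<Rightarrow> (real^'k) \<times> (real^'n) \<Rightarrow> real^'n" where
  "normal_solve A v = matrix_inv (transpose A ** A + mat 1) *v (transpose A *v fst v + snd v)"

text \<open>Pairing the kernel equation with \<open>x\<close> leaves the squared norms of
  \<open>A *v x\<close> and \<open>x\<close> with sum zero, so the kernel is trivial.\<close>

lemma invertible_normal_matrix: "invertible (transpose A ** A + mat 1 :: real^'n^'n)"
  for A :: "real^'n^'k"
proof -
  have "inj ((*v) (transpose A ** A + mat 1))"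
  proof (rule linear_injective_0[THEN iffD2, rule_format])
    fix x assume "(transpose A ** A + mat 1) *v x = 0"
    then have "x \<bullet> (transpose A *v (A *v x)) + x \<bullet> x = 0"
      by (metis inner_add_right inner_zero_right matrix_vector_mul_assoc matrix_vector_mul_lid
          matrix_vector_mult_add_rdistrib)
    then have "(A *v x) \<bullet> (A *v x) + x \<bullet> x = 0" by (simp add: inner_matrix_vector_mul)
    then show "x = 0"
      by (metis add_nonneg_eq_0_iff inner_eq_zero_iff inner_ge_zero)
  qed simp
  then show ?thesis
    by (simp add: invertible_left_inverse matrix_left_invertible_injective)
qed

lemma normal_solve_iff:
  fixes A :: "real^'n^'k"
  shows "x = normal_solve A v \<longleftrightarrow> transpose A *v (A *v x - fst v) + (x - snd v) = 0"
proof -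
  let ?M = "transpose A ** A + mat 1"
  have inv: "?M ** matrix_inv ?M = mat 1" "matrix_inv ?M ** ?M = mat 1"
    using invertible_normal_matrix[of A] unfolding invertible_def matrix_inv_def
    by (metis (mono_tags, lifting) someI_ex)+
  have "x = normal_solve A v \<longleftrightarrow> ?M *v x = transpose A *v fst v + snd v"
    unfolding normal_solve_def using inv by (metis matrix_vector_mul_assoc matrix_vector_mul_lid)
  also have "\<dots> \<longleftrightarrow> transpose A *v (A *v x - fst v) + (x - snd v) = 0"
    by (simp add: matrix_vector_mult_add_rdistrib matrix_vector_mult_diff_distrib algebra_simps
        flip: matrix_vector_mul_assoc)
  finally show ?thesis .
qed

text \<open>The proximal map of \<open>csunsal_f2 y \<delta> lam\<close> divided by \<mu>, where
  \<open>\<tau> = lam / \<mu>\<close>. Pairs take the place of stacked vectors.\<close>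

definition prox :: "real^'k \<Rightarrow> real \<Rightarrow> real \<Rightarrow> (real^'k) \<times> (real^'n) \<Rightarrow> (real^'k) \<times> (real^'n)" where
  "prox y \<delta> \<tau> s = (ball_proj y \<delta> (fst s), pos_part (soft (snd s) \<tau>))"

text \<open>The orthogonal projection onto the graph of \<open>A\<close>, which is the range of
  \<open>csunsal_G A\<close> written in pairs.\<close>

definition graph_proj :: "real^'n^'k \<Rightarrow> (real^'k) \<times> (real^'n) \<Rightarrow> (real^'k) \<times> (real^'n)" where
  "graph_proj A v = (A *v normal_solve A v, normal_solve A v)"

definition dr_step ::
  "real^'n^'k \<Rightarrow> real^'k \<Rightarrow> real \<Rightarrow> real \<Rightarrow> (real^'k) \<times> (real^'n) \<Rightarrow> (real^'k) \<times> (real^'n)" where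
  "dr_step A y \<delta> \<tau> s = s + graph_proj A (2 *\<^sub>R prox y \<delta> \<tau> s - s) - prox y \<delta> \<tau> s"

lemma normal_solve_linear:
  "normal_solve A (v - w) = normal_solve A v - normal_solve A w"
  by (simp add: normal_solve_def matrix_vector_mult_diff_distrib algebra_simps)

lemma graph_proj_diff: "graph_proj A (v - w) = graph_proj A v - graph_proj A w"
  by (simp add: graph_proj_def normal_solve_linear matrix_vector_mult_diff_distrib)

lemma graph_proj_orthogonal: "(A *v h, h) \<bullet> (v - graph_proj A v) = 0"
proof -
  have "transpose A *v (A *v normal_solve A v - fst v) + (normal_solve A v - snd v) = 0"
    using normal_solve_iff by blast
  then have "h \<bullet> (transpose A *v (A *v normal_solve A v - fst v)) + h \<bullet> (normal_solve A v - snd v) = 0"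
    by (metis inner_add_right inner_zero_right)
  then have "(A *v h) \<bullet> (A *v normal_solve A v - fst v) + h \<bullet> (normal_solve A v - snd v) = 0"
    by (simp add: inner_matrix_vector_mul)
  then show ?thesis by (simp add: graph_proj_def inner_prod_def inner_diff_right)
qed

text \<open>Each proximal inequality is tested at the other proximal point; in the sum the \<tau>
  terms cancel.\<close>

lemma prox_monotone:
  fixes y :: "real^'k" and s t :: "(real^'k) \<times> (real^'n)"
  assumes "\<delta> \<ge> 0" "\<tau> \<ge> 0"
  shows "0 \<le> (prox y \<delta> \<tau> s - prox y \<delta> \<tau> t) \<bullet> ((s - prox y \<delta> \<tau> s) - (t - prox y \<delta> \<tau> t))"
proof -
  have ball: "(fst s - ball_proj y \<delta> (fst s)) \<bullet> (ball_proj y \<delta> (fst t) - ball_proj y \<delta> (fst s)) \<le> 0"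
    for s t :: "(real^'k) \<times> (real^'n)"
    using assms(1) by (intro ball_proj_variational ball_proj_in_cball)
  have orthant: "(snd s - pos_part (soft (snd s) \<tau>)) \<bullet> (pos_part (soft (snd t) \<tau>) - pos_part (soft (snd s) \<tau>))
      \<le> \<tau> * (1 \<bullet> (pos_part (soft (snd t) \<tau>) - pos_part (soft (snd s) \<tau>)))"
    for s t :: "(real^'k) \<times> (real^'n)"
    using assms(2) by (intro pos_part_soft_variational pos_part_in_orthant)
  show ?thesis
    using ball[of s t] ball[of t s] orthant[of s t] orthant[of t s]
    by (simp add: prox_def inner_prod_def inner_simps algebra_simps inner_commute)
qed

text \<open>With \<open>u\<close>, \<open>g\<close>, \<open>w\<close> as in the proof, the right
  side minus the left side is \<open>2 * (u \<bullet> g) + 2 * (w \<bullet> (u - g - w))\<close>.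
  The first term is nonnegative because the proximal map is monotone, and the second is zero because
  \<open>w\<close> projects \<open>u - g\<close> onto the graph.\<close>

lemma firmly_nonexpansive_dr_step:
  fixes A :: "real^'n^'k"
  assumes "\<delta> \<ge> 0" "\<tau> \<ge> 0"
  shows "firmly_nonexpansive (dr_step A y \<delta> \<tau>)"
  unfolding firmly_nonexpansive_def
proof (intro allI)
  fix s t :: "(real^'k) \<times> (real^'n)"
  let ?P = "prox y \<delta> \<tau>" and ?T = "dr_step A y \<delta> \<tau>"
  define u where "u = ?P s - ?P t"
  define g where "g = (s - ?P s) - (t - ?P t)"
  define w where "w = graph_proj A (u - g)"
  have "u - g = (2 *\<^sub>R ?P s - s) - (2 *\<^sub>R ?P t - t)"
    by (simp add: u_def g_def algebra_simps scaleR_2)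
  then have w_eq: "w = graph_proj A (2 *\<^sub>R ?P s - s) - graph_proj A (2 *\<^sub>R ?P t - t)"
    by (simp only: w_def graph_proj_diff)
  have T: "?T s - ?T t = w + g" "(s - ?T s) - (t - ?T t) = u - w"
    by (simp_all add: dr_step_def w_eq u_def g_def)
  have st: "s - t = u + g" by (simp add: u_def g_def)
  have "w \<bullet> (u - g - w) = 0"
    using graph_proj_orthogonal[of A "normal_solve A (u - g)" "u - g"] by (simp add: w_def graph_proj_def)
  moreover have "0 \<le> u \<bullet> g" unfolding u_def g_def by (rule prox_monotone[OF assms])
  ultimately show "(norm (?T s - ?T t))\<^sup>2 + (norm ((s - ?T s) - (t - ?T t)))\<^sup>2 \<le> (norm (s - t))\<^sup>2"
    unfolding T st power2_norm_eq_inner by (simp add: inner_simps inner_commute)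
qed

section \<open>Exact and approximate fixed points\<close>

lemma pos_part_soft_unique:
  assumes "\<tau> \<ge> 0" "x \<in> nonneg_orthant"
    and vi: "\<And>z. z \<in> nonneg_orthant \<Longrightarrow> (v - x) \<bullet> (z - x) \<le> \<tau> * (1 \<bullet> (z - x))"
  shows "pos_part (soft v \<tau>) = x"
proof -
  let ?p = "pos_part (soft v \<tau>)"
  have "(v - x) \<bullet> (?p - x) \<le> \<tau> * (1 \<bullet> (?p - x))" using vi pos_part_in_orthant by blast
  moreover have "(v - ?p) \<bullet> (x - ?p) \<le> \<tau> * (1 \<bullet> (x - ?p))"
    using assms pos_part_soft_variational by blast
  ultimately have "(x - ?p) \<bullet> (x - ?p) \<le> 0" by (simp add: inner_simps inner_commute algebra_simps)
  then show ?thesis by (metis eq_iff_diff_eq_0 inner_eq_zero_iff inner_ge_zero order_antisym)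
qed

lemma inner_graph_normal:
  fixes A :: "real^'n^'k"
  shows "(A *v h, h) \<bullet> (\<gamma>, - (transpose A *v \<gamma>)) = 0"
  by (simp add: inner_prod_def inner_matrix_vector_mul)

text \<open>At a fixed point the proximal point lies on the graph, and its difference from
  \<open>s\<close> is normal to the graph. In the sum of the two variational inequalities this
  normal pairs to zero with the direction towards \<open>z\<close>, so only the \<tau> terms
  survive.\<close>

lemma dr_step_fixed_point_optimal:
  fixes A :: "real^'n^'k"
  assumes "\<delta> \<ge> 0" "\<tau> \<ge> 0" and fixed: "dr_step A y \<delta> \<tau> s = s"
  defines "x \<equiv> snd (prox y \<delta> \<tau> s)"
  shows "cbpdn_feasible A y \<delta> x"
    and "cbpdn_feasible A y \<delta> z \<Longrightarrow> \<tau> * (1 \<bullet> x) \<le> \<tau> * (1 \<bullet> z)"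
proof -
  let ?u = "prox y \<delta> \<tau> s"
  have w: "graph_proj A (2 *\<^sub>R ?u - s) = ?u"
    using fixed by (simp add: dr_step_def diff_eq_eq)
  then have u: "?u = (A *v x, x)"
    by (metis graph_proj_def snd_conv x_def)
  have u1: "ball_proj y \<delta> (fst s) = A *v x" and u2: "pos_part (soft (snd s) \<tau>) = x"
    using u by (simp_all add: prox_def)
  show "cbpdn_feasible A y \<delta> x"
    using ball_proj_in_cball[OF assms(1), of y "fst s"] pos_part_in_orthant[of "soft (snd s) \<tau>"]
    unfolding u1 u2 by (simp add: cbpdn_feasible_def dist_norm norm_minus_commute)
  assume "cbpdn_feasible A y \<delta> z"
  then have "A *v z \<in> cball y \<delta>" "z \<in> nonneg_orthant"
    by (simp_all add: cbpdn_feasible_def dist_norm norm_minus_commute)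
  then have "(fst s - A *v x) \<bullet> (A *v z - A *v x) \<le> 0" "(snd s - x) \<bullet> (z - x) \<le> \<tau> * (1 \<bullet> (z - x))"
    using ball_proj_variational[OF assms(1), of "A *v z" y "fst s"]
      pos_part_soft_variational[OF assms(2), of z "snd s"] by (simp_all add: u1 u2)
  moreover have "(A *v (z - x), z - x) \<bullet> (2 *\<^sub>R ?u - s - ?u) = 0"
    using graph_proj_orthogonal[of A "z - x" "2 *\<^sub>R ?u - s"] by (simp add: w)
  ultimately show "\<tau> * (1 \<bullet> x) \<le> \<tau> * (1 \<bullet> z)"
    by (simp add: u inner_prod_def inner_simps matrix_vector_mult_diff_distrib inner_commute algebra_simps)
qed

text \<open>The hypotheses say that \<gamma> and \<open>- (transpose A *v \<gamma>)\<close> satisfy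
  the proximal conditions at \<open>p\<close> and \<open>x\<close>. Reflecting \<open>t\<close> at
  \<open>(p, x)\<close> then subtracts the graph normal
  \<open>(\<gamma>, - (transpose A *v \<gamma>))\<close>, which the projection ignores. The
  displacement of \<open>t\<close> is thus the vector from the graph to \<open>(p, x)\<close>, no
  longer than the one from \<open>(A *v x, x)\<close>.\<close>

lemma dr_step_approximate_fixed_point:
  fixes A :: "real^'n^'k"
  assumes "\<delta> \<ge> 0" "\<tau> \<ge> 0" "p \<in> cball y \<delta>" "x \<in> nonneg_orthant"
    and ball: "\<And>z. z \<in> cball y \<delta> \<Longrightarrow> \<gamma> \<bullet> (z - p) \<le> 0"
    and orthant: "\<And>z. z \<in> nonneg_orthant \<Longrightarrow> - (transpose A *v \<gamma>) \<bullet> (z - x) \<le> \<tau> * (1 \<bullet> (z - x))"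
  defines "t \<equiv> (p + \<gamma>, x - transpose A *v \<gamma>)"
  shows "prox y \<delta> \<tau> t = (p, x)" and "norm (t - dr_step A y \<delta> \<tau> t) \<le> norm (p - A *v x)"
proof -
  show prox: "prox y \<delta> \<tau> t = (p, x)"
  proof -
    have "ball_proj y \<delta> (p + \<gamma>) = p"
      using assms(1,3) ball by (intro ball_proj_unique) simp_all
    moreover have "pos_part (soft (x - transpose A *v \<gamma>) \<tau>) = x"
      using assms(2,4) orthant by (intro pos_part_soft_unique) simp_all
    ultimately show ?thesis by (simp add: prox_def t_def)
  qed
  define v where "v = (p, x) - (\<gamma>, - (transpose A *v \<gamma>))"
  define w where "w = graph_proj A v"
  have "v = 2 *\<^sub>R prox y \<delta> \<tau> t - t"
    unfolding prox by (simp add: v_def t_def scaleR_2 algebra_simps)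
  then have step: "t - dr_step A y \<delta> \<tau> t = (p, x) - w"
    by (simp add: dr_step_def w_def prox)
  define h where "h = x - normal_solve A v"
  have qw: "(A *v x, x) - w = (A *v h, h)"
    by (simp add: w_def graph_proj_def h_def matrix_vector_mult_diff_distrib)
  have "(A *v h, h) \<bullet> (v - w) = 0"
    unfolding w_def by (rule graph_proj_orthogonal)
  then have orth: "((A *v x, x) - w) \<bullet> ((p, x) - w) = 0"
    using inner_graph_normal[of A h \<gamma>] unfolding qw by (simp add: v_def inner_diff_right inner_add_right)
  have "(norm (t - dr_step A y \<delta> \<tau> t))\<^sup>2 \<le> (norm ((p, x) - (A *v x, x)))\<^sup>2"
  proof -
    have "(norm ((p, x) - (A *v x, x)))\<^sup>2
        = (norm ((p, x) - w))\<^sup>2 + (norm ((A *v x, x) - w))\<^sup>2 - 2 * (((A *v x, x) - w) \<bullet> ((p, x) - w))"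
      by (simp only: power2_norm_eq_inner) (simp add: inner_simps inner_commute)
    then show ?thesis by (simp add: step orth)
  qed
  then have "norm (t - dr_step A y \<delta> \<tau> t) \<le> norm ((p, x) - (A *v x, x))"
    by (rule power2_le_imp_le) simp
  then show "norm (t - dr_step A y \<delta> \<tau> t) \<le> norm (p - A *v x)"
    by (simp add: norm_Pair)
qed

section \<open>Penalty problems as a source of approximate fixed points\<close>

lemma nonneg_if_affine_nonneg_near_zero:
  fixes a b :: real
  assumes "\<And>\<theta>. 0 < \<theta> \<Longrightarrow> \<theta> \<le> 1 \<Longrightarrow> 0 \<le> a + \<theta> * b"
  shows "0 \<le> a"
proof (rule tendsto_lowerbound)
  show "((\<lambda>\<theta>. a + \<theta> * b) \<longlongrightarrow> a) (at_right 0)"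
    by (auto intro!: tendsto_eq_intros)
  show "\<forall>\<^sub>F \<theta> in at_right 0. 0 \<le> a + \<theta> * b"
    using assms by (auto simp: eventually_at_right_field intro!: exI[of _ 1])
qed simp

text \<open>The orthant is cut down to the compact set \<open>K\<close> of points whose linear cost
  does not exceed that of \<open>z\<close>. Points outside \<open>K\<close> already cost more than
  \<open>(z, A *v z)\<close>, which has no penalty.\<close>

lemma penalty_minimizer_exists:
  fixes A :: "real^'n^'k"
  assumes "\<tau> > 0" "t \<ge> 0" and feas: "cbpdn_feasible A y \<delta> z"
  obtains x p where "x \<in> nonneg_orthant" "p \<in> cball y \<delta>"
    "\<And>x' p'. x' \<in> nonneg_orthant \<Longrightarrow> p' \<in> cball y \<delta> \<Longrightarrow>
       \<tau> * (1 \<bullet> x) + t / 2 * (norm (A *v x - p))\<^sup>2 \<le> \<tau> * (1 \<bullet> x') + t / 2 * (norm (A *v x' - p'))\<^sup>2"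
proof -
  define F :: "(real^'n) \<times> (real^'k) \<Rightarrow> real" where "F = (\<lambda>(x, p). \<tau> * (1 \<bullet> x) + t / 2 * (norm (A *v x - p))\<^sup>2)"
  define K :: "(real^'n) set" where "K = {x \<in> nonneg_orthant. \<tau> * (1 \<bullet> x) \<le> \<tau> * (1 \<bullet> z)}"
  have z: "z \<in> K" "A *v z \<in> cball y \<delta>"
    using feas by (auto simp: K_def cbpdn_feasible_def dist_norm norm_minus_commute)
  have "norm x \<le> 1 \<bullet> z" if "x \<in> K" for x
    using that norm_le_l1_norm[of x] l1_norm_orthant[of x] \<open>\<tau> > 0\<close> by (simp add: K_def)
  then have "bounded K" by (auto simp: bounded_iff)
  moreover have "closed K"
    unfolding K_def Collect_conj_eq Collect_mem_eq
    by (intro closed_Int closed_nonneg_orthant closed_Collect_le continuous_intros)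
  ultimately have "compact (K \<times> cball y \<delta>)"
    by (intro compact_Times compact_cball) (simp add: compact_eq_bounded_closed)
  moreover have "continuous_on (K \<times> cball y \<delta>) F"
    unfolding F_def case_prod_beta
    by (intro continuous_intros linear_continuous_on_compose[OF _ matrix_vector_mul_linear])
  moreover have "K \<times> cball y \<delta> \<noteq> {}" using z by blast
  ultimately obtain m where m: "m \<in> K \<times> cball y \<delta>" "\<And>m'. m' \<in> K \<times> cball y \<delta> \<Longrightarrow> F m \<le> F m'"
    using continuous_attains_inf by metis
  obtain x p where xp: "m = (x, p)" by fastforce
  show thesis
  proof (rule that)
    show "x \<in> nonneg_orthant" "p \<in> cball y \<delta>" using m(1) by (auto simp: xp K_def)
    fix x' :: "real^'n" and p' assume x': "x' \<in> nonneg_orthant" and p': "p' \<in> cball y \<delta>"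
    have "F m \<le> F (x', p')"
    proof (cases "x' \<in> K")
      case True then show ?thesis using m(2) p' by blast
    next
      case False
      have "F m \<le> F (z, A *v z)" using m(2) z by blast
      also have "\<dots> = \<tau> * (1 \<bullet> z)" by (simp add: F_def)
      also have "\<dots> \<le> \<tau> * (1 \<bullet> x')" using False x' by (simp add: K_def)
      also have "\<dots> \<le> F (x', p')" using \<open>t \<ge> 0\<close> by (simp add: F_def)
      finally show ?thesis .
    qed
    then show "\<tau> * (1 \<bullet> x) + t / 2 * (norm (A *v x - p))\<^sup>2 \<le> \<tau> * (1 \<bullet> x') + t / 2 * (norm (A *v x' - p'))\<^sup>2"
      by (simp add: F_def xp)
  qed
qed

text \<open>Moving from \<open>(x, p)\<close> towards \<open>(x', p')\<close> by a fraction
  \<theta>, expanding the square and dividing by \<theta> gives an affine expression in \<theta>;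
  its value at zero is the first-order condition.\<close>

lemma penalty_minimizer_variational:
  fixes A :: "real^'n^'k"
  assumes x: "x \<in> nonneg_orthant" and p: "p \<in> cball y \<delta>"
    and min: "\<And>x' p'. x' \<in> nonneg_orthant \<Longrightarrow> p' \<in> cball y \<delta> \<Longrightarrow>
       \<tau> * (1 \<bullet> x) + t / 2 * (norm (A *v x - p))\<^sup>2 \<le> \<tau> * (1 \<bullet> x') + t / 2 * (norm (A *v x' - p'))\<^sup>2"
    and x': "x' \<in> nonneg_orthant" and p': "p' \<in> cball y \<delta>"
  shows "0 \<le> \<tau> * (1 \<bullet> (x' - x)) + (t *\<^sub>R (A *v x - p)) \<bullet> (A *v (x' - x) - (p' - p))"
proof (rule nonneg_if_affine_nonneg_near_zero)
  fix \<theta> :: real assume \<theta>: "0 < \<theta>" "\<theta> \<le> 1"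
  define h where "h = x' - x"
  define k where "k = A *v h - (p' - p)"
  define e where "e = A *v x - p"
  have "x + \<theta> *\<^sub>R h \<in> nonneg_orthant"
    using convexD_alt[OF convex_nonneg_orthant x x', of \<theta>] \<theta>
    by (simp add: h_def algebra_simps)
  moreover have "p + \<theta> *\<^sub>R (p' - p) \<in> cball y \<delta>"
    using convexD_alt[OF convex_cball p p', of \<theta>] \<theta> by (simp add: algebra_simps)
  ultimately have "\<tau> * (1 \<bullet> x) + t / 2 * (norm e)\<^sup>2 \<le> \<tau> * (1 \<bullet> (x + \<theta> *\<^sub>R h))
      + t / 2 * (norm (A *v (x + \<theta> *\<^sub>R h) - (p + \<theta> *\<^sub>R (p' - p))))\<^sup>2"
    unfolding e_def by (rule min)
  moreover have "A *v (x + \<theta> *\<^sub>R h) - (p + \<theta> *\<^sub>R (p' - p)) = e + \<theta> *\<^sub>R k"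
    by (simp add: e_def k_def matrix_vector_right_distrib matrix_vector_mult_scaleR algebra_simps)
  moreover have "(norm (e + \<theta> *\<^sub>R k))\<^sup>2 = (norm e)\<^sup>2 + \<theta> * (2 * (e \<bullet> k) + \<theta> * (norm k)\<^sup>2)"
    by (simp add: power2_norm_eq_inner inner_simps inner_commute algebra_simps)
  ultimately have "0 \<le> \<theta> * (\<tau> * (1 \<bullet> h) + t * (e \<bullet> k) + \<theta> * (t / 2 * (norm k)\<^sup>2))"
    by (simp add: inner_add_right algebra_simps)
  then show "0 \<le> \<tau> * (1 \<bullet> (x' - x)) + (t *\<^sub>R (A *v x - p)) \<bullet> (A *v (x' - x) - (p' - p))
      + \<theta> * (t / 2 * (norm k)\<^sup>2)"
    using \<theta> by (simp add: zero_le_mult_iff h_def e_def k_def)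
qed

lemma dr_step_approximate_fixed_points:
  fixes A :: "real^'n^'k"
  assumes "\<delta> \<ge> 0" "\<tau> > 0" "\<epsilon> > 0" and feas: "cbpdn_feasible A y \<delta> z"
  shows "\<exists>s. norm (s - dr_step A y \<delta> \<tau> s) \<le> \<epsilon>"
proof -
  have z: "z \<in> nonneg_orthant" "A *v z \<in> cball y \<delta>"
    using feas by (auto simp: cbpdn_feasible_def dist_norm norm_minus_commute)
  have z1: "0 \<le> 1 \<bullet> z" using l1_norm_nonneg[of z] l1_norm_orthant[OF z(1)] by simp
  \<comment> \<open>Comparison with \<open>z\<close> bounds the penalty at the minimizer by
    \<open>\<tau> * (1 \<bullet> z)\<close>. This weight turns that bound into a residual of at most
    \<epsilon>, and the summand 1 keeps it positive.\<close>
  define t where "t = 2 * (\<tau> * (1 \<bullet> z)) / \<epsilon>\<^sup>2 + 1"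
  have t: "t > 0" using z1 assms by (simp add: t_def add_nonneg_pos)
  obtain x p where x: "x \<in> nonneg_orthant" and p: "p \<in> cball y \<delta>"
    and min: "\<And>x' p'. x' \<in> nonneg_orthant \<Longrightarrow> p' \<in> cball y \<delta> \<Longrightarrow>
       \<tau> * (1 \<bullet> x) + t / 2 * (norm (A *v x - p))\<^sup>2 \<le> \<tau> * (1 \<bullet> x') + t / 2 * (norm (A *v x' - p'))\<^sup>2"
    using penalty_minimizer_exists[OF assms(2) _ feas, of t] t by (metis less_imp_le)
  \<comment> \<open>The scaled residual is the multiplier of the penalty problem. Freezing
    \<open>x\<close> or \<open>p\<close> in the first-order condition yields the two proximal
    conditions for it.\<close>
  define \<gamma> where "\<gamma> = t *\<^sub>R (A *v x - p)"
  have "\<gamma> \<bullet> (q - p) \<le> 0" if "q \<in> cball y \<delta>" for q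
    using penalty_minimizer_variational[OF x p min x that]
    by (simp add: \<gamma>_def inner_diff_right algebra_simps)
  moreover have "- (transpose A *v \<gamma>) \<bullet> (x' - x) \<le> \<tau> * (1 \<bullet> (x' - x))" if "x' \<in> nonneg_orthant" for x'
    using penalty_minimizer_variational[OF x p min that p]
    by (simp add: \<gamma>_def inner_matrix_vector_mul inner_commute matrix_vector_mult_scaleR)
  ultimately have "norm ((p + \<gamma>, x - transpose A *v \<gamma>) - dr_step A y \<delta> \<tau> (p + \<gamma>, x - transpose A *v \<gamma>))
      \<le> norm (p - A *v x)"
    using assms x p by (intro dr_step_approximate_fixed_point) auto
  also have "norm (p - A *v x) \<le> \<epsilon>"
  proof (rule power2_le_imp_le)
    have "0 \<le> 1 \<bullet> x" using l1_norm_nonneg[of x] l1_norm_orthant[OF x] by simp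
    then have "0 \<le> \<tau> * (1 \<bullet> x)" using \<open>\<tau> > 0\<close> by (intro mult_nonneg_nonneg) simp_all
    moreover have "\<tau> * (1 \<bullet> x) + t / 2 * (norm (A *v x - p))\<^sup>2 \<le> \<tau> * (1 \<bullet> z)"
      using min[OF z] by simp
    ultimately have "t / 2 * (norm (A *v x - p))\<^sup>2 \<le> \<tau> * (1 \<bullet> z)" by linarith
    also have "\<dots> \<le> t / 2 * \<epsilon>\<^sup>2" using \<open>\<epsilon> > 0\<close> by (simp add: t_def field_simps)
    finally show "(norm (p - A *v x))\<^sup>2 \<le> \<epsilon>\<^sup>2" using t by (simp add: norm_minus_commute)
  qed (use assms in simp)
  finally show ?thesis by blast
qed

section \<open>Convergence of the shadow sequence\<close>

lemma eventually_near_subsequential_limits: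
  fixes X :: "nat \<Rightarrow> 'a::heine_borel"
  assumes bdd: "bounded (range X)"
    and lims: "\<And>r l. strict_mono r \<Longrightarrow> (X \<circ> r) \<longlonglongrightarrow> l \<Longrightarrow> l \<in> \<Phi>"
    and "e > 0"
  shows "\<forall>\<^sub>F j in sequentially. \<exists>\<phi>\<in>\<Phi>. dist (X j) \<phi> < e"
proof (rule ccontr)
  assume "\<not> ?thesis"
  then have "infinite {j. \<not> (\<exists>\<phi>\<in>\<Phi>. dist (X j) \<phi> < e)}"
    unfolding infinite_nat_iff_unbounded_le eventually_sequentially by blast
  from infinite_enumerate[OF this] obtain r :: "nat \<Rightarrow> nat"
    where r: "strict_mono r" "\<And>n. \<not> (\<exists>\<phi>\<in>\<Phi>. dist (X (r n)) \<phi> < e)"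
    by auto
  have "bounded (range (X \<circ> r))"
    by (rule bounded_subset[OF bdd]) auto
  then obtain l q where q: "strict_mono q" "((X \<circ> r) \<circ> q) \<longlonglongrightarrow> l"
    using bounded_imp_convergent_subsequence by blast
  have "l \<in> \<Phi>"
    using q r(1) by (intro lims[of "r \<circ> q"]) (auto simp: o_assoc intro: strict_mono_o)
  moreover obtain n where "dist ((X \<circ> r \<circ> q) n) l < e"
    using tendstoD[OF q(2) \<open>e > 0\<close>] by (auto simp: eventually_sequentially)
  ultimately show False using r(2)[of "q n"] by auto
qed

lemma bounded_unique_subsequential_limit:
  fixes X :: "nat \<Rightarrow> 'a::heine_borel"
  assumes "bounded (range X)" "\<And>r l'. strict_mono r \<Longrightarrow> (X \<circ> r) \<longlonglongrightarrow> l' \<Longrightarrow> l' = l"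
  shows "X \<longlonglongrightarrow> l"
proof (rule tendstoI)
  fix e :: real assume "e > 0"
  then show "\<forall>\<^sub>F j in sequentially. dist (X j) l < e"
    using eventually_near_subsequential_limits[OF assms(1), of "{l}" e] assms(2) by simp
qed

lemma tendsto_matrix_vector_mul:
  fixes B :: "real^'m^'l"
  assumes "(f \<longlongrightarrow> x) F" shows "((\<lambda>j. B *v f j) \<longlongrightarrow> B *v x) F"
  using assms by (rule bounded_linear.tendsto[OF matrix_vector_mul_bounded_linear])

lemma convergent_if_increments_summable:
  fixes f :: "nat \<Rightarrow> real"
  assumes "summable (\<lambda>j. f (Suc j) - f j)"
  shows "convergent f"
proof -
  have "convergent (\<lambda>n. \<Sum>j<n. f (Suc j) - f j)"
    using assms by (simp add: summable_iff_convergent)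
  then have "convergent (\<lambda>n. f n - f 0)" by (simp add: sum_lessThan_telescope)
  then show ?thesis using convergent_add_const_right_iff[of f "- f 0"] by simp
qed

text \<open>With threshold zero every feasible point is optimal with multiplier 0, so the
  approximate fixed point built from it has displacement bounded by zero.\<close>

lemma dr_step_zero_threshold_fixed_point:
  fixes A :: "real^'n^'k"
  assumes "\<delta> \<ge> 0" "cbpdn_feasible A y \<delta> z"
  shows "dr_step A y \<delta> 0 (A *v z, z) = (A *v z, z)"
proof -
  let ?t = "(A *v z + 0, z - transpose A *v 0)"
  have "norm (?t - dr_step A y \<delta> 0 ?t) \<le> norm (A *v z - A *v z)"
    using assms
    by (intro dr_step_approximate_fixed_point)
      (auto simp: cbpdn_feasible_def dist_norm norm_minus_commute)
  then have "?t - dr_step A y \<delta> 0 ?t = 0"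
    by (simp only: diff_self norm_zero norm_le_zero_iff)
  then show ?thesis by simp
qed

text \<open>\<open>u1\<close> and \<open>u2\<close> form the shadow sequence. \<open>g\<close> is the multiplier of the ball constraint and \<open>r\<close> that of
  \<open>x \<ge> 0\<close>; a dual solution would be a common limit point of them with \<open>r - \<tau> 1 = A\<^sup>T g\<close>.\<close>

locale dr_orbit =
  fixes A :: "real^'n^'k" and y :: "real^'k" and \<delta> \<tau> :: real
    and S :: "nat \<Rightarrow> (real^'k) \<times> (real^'n)"
  assumes delta_nonneg: "\<delta> \<ge> 0" and tau_nonneg: "\<tau> \<ge> 0"
    and feasible: "\<exists>z. cbpdn_feasible A y \<delta> z"
    and orbit: "\<And>j. S (Suc j) = dr_step A y \<delta> \<tau> (S j)"
begin

definition u1 :: "nat \<Rightarrow> real^'k" where "u1 j = fst (prox y \<delta> \<tau> (S j))"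
definition u2 :: "nat \<Rightarrow> real^'n" where "u2 j = snd (prox y \<delta> \<tau> (S j))"
definition g :: "nat \<Rightarrow> real^'k" where "g j = fst (S j) - u1 j"
definition r :: "nat \<Rightarrow> real^'n" where "r j = \<tau> *\<^sub>R 1 + u2 j - snd (S j)"
text \<open>For an orbit that comes from the algorithm this is the primal iterate with index
  \<open>Suc (Suc j)\<close>.\<close>

definition w :: "nat \<Rightarrow> real^'n" where "w j = normal_solve A (2 *\<^sub>R prox y \<delta> \<tau> (S j) - S j)"

lemma u1_in_cball: "u1 j \<in> cball y \<delta>"
  using delta_nonneg by (simp add: u1_def prox_def ball_proj_in_cball del: mem_cball)

lemma norm_u1_le: "norm (u1 j) \<le> norm y + \<delta>"
  using u1_in_cball[of j] norm_triangle_sub[of "u1 j" y] by (simp add: dist_norm norm_minus_commute)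

lemma g_normal: "z \<in> cball y \<delta> \<Longrightarrow> g j \<bullet> (z - u1 j) \<le> 0"
  using ball_proj_variational[OF delta_nonneg, of z y "fst (S j)"] by (simp add: g_def u1_def prox_def)

lemma u2_in_orthant: "u2 j \<in> nonneg_orthant"
  by (simp add: u2_def prox_def pos_part_in_orthant)

lemma u2_nonneg: "0 \<le> u2 j $ i"
  using u2_in_orthant by (simp add: nonneg_orthant_def)

text \<open>\<open>u2 j\<close> and \<open>r j\<close> are the positive and the negative part of
  \<open>snd (S j) - \<tau> *\<^sub>R 1\<close>.\<close>

lemma r_nonneg: "0 \<le> r j $ i" and r_complementary: "r j $ i * u2 j $ i = 0"
  by (auto simp: r_def u2_def prox_def pos_part_soft[OF tau_nonneg] max_def)

lemma r_eq_0: "0 < u2 j $ i \<Longrightarrow> r j $ i = 0"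
  using r_complementary[of j i] by auto

lemma r_inner_u2: "r j \<bullet> u2 j = 0"
  by (simp add: inner_vec_def r_complementary)

lemma S_eq: "S j = (u1 j + g j, u2 j + \<tau> *\<^sub>R 1 - r j)"
  by (simp add: g_def r_def)

lemma S_step: "S j - S (Suc j) = (u1 j - A *v w j, u2 j - w j)"
  by (simp add: orbit dr_step_def graph_proj_def u1_def u2_def w_def prod_eq_iff)

lemma normal_equation:
  "transpose A *v (A *v w j - (u1 j - g j)) + (w j - (u2 j + r j - \<tau> *\<^sub>R 1)) = 0"
proof -
  have "2 *\<^sub>R prox y \<delta> \<tau> (S j) - S j = (u1 j - g j, u2 j + r j - \<tau> *\<^sub>R 1)"
    by (simp add: prod_eq_iff g_def r_def u1_def u2_def scaleR_2)
  then show ?thesis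
    using iffD1[OF normal_solve_iff w_def[of j]] by simp
qed

lemma asymptotically_regular: "(\<lambda>j. S j - S (Suc j)) \<longlonglongrightarrow> 0"
proof (rule firmly_nonexpansive_asymptotically_regular[where T = "dr_step A y \<delta> \<tau>" and S = S])
  fix e :: real assume "e > 0"
  obtain z where z: "cbpdn_feasible A y \<delta> z" using feasible by blast
  show "\<exists>t. norm (t - dr_step A y \<delta> \<tau> t) \<le> e"
  proof (cases "\<tau> = 0")
    case True
    then have "norm ((A *v z, z) - dr_step A y \<delta> \<tau> (A *v z, z)) \<le> e"
      using dr_step_zero_threshold_fixed_point[OF delta_nonneg z] \<open>e > 0\<close> by simp
    then show ?thesis by blast
  next
    case False
    then show ?thesis
      using dr_step_approximate_fixed_points[OF delta_nonneg _ \<open>e > 0\<close> z] tau_nonneg by simp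
  qed
qed (intro firmly_nonexpansive_dr_step delta_nonneg tau_nonneg orbit)+

lemma u1_minus_Aw: "(\<lambda>j. u1 j - A *v w j) \<longlonglongrightarrow> 0"
  using tendsto_fst[OF asymptotically_regular] by (simp add: S_step)

lemma u2_minus_w: "(\<lambda>j. u2 j - w j) \<longlonglongrightarrow> 0"
  using tendsto_snd[OF asymptotically_regular] by (simp add: S_step)

lemma Au2_minus_u1: "(\<lambda>j. A *v u2 j - u1 j) \<longlonglongrightarrow> 0"
proof -
  have "(\<lambda>j. A *v (u2 j - w j) - (u1 j - A *v w j)) \<longlonglongrightarrow> A *v 0 - 0"
    by (intro tendsto_diff tendsto_matrix_vector_mul u1_minus_Aw u2_minus_w)
  then show ?thesis by (simp add: matrix_vector_mult_diff_distrib)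
qed

text \<open>The residual of the dual equation. It can tend to zero although \<open>r\<close> and
  \<open>g\<close> are unbounded.\<close>

definition eps :: "nat \<Rightarrow> real^'n" where "eps j = r j - \<tau> *\<^sub>R 1 - transpose A *v g j"

text \<open>The normal equation expresses the residual as a fixed linear image of the displacement
  of \<open>S\<close>, which tends to zero.\<close>

lemma eps_tendsto_0: "eps \<longlonglongrightarrow> 0"
proof -
  have "eps = (\<lambda>j. - (transpose A *v (u1 j - A *v w j) + (u2 j - w j)))"
  proof
    fix j
    show "eps j = - (transpose A *v (u1 j - A *v w j) + (u2 j - w j))"
      using normal_equation[of j]
      by (simp add: eps_def matrix_vector_mult_diff_distrib matrix_vector_right_distrib algebra_simps
          del: transpose_matrix_vector)
  qed
  moreover have "(\<lambda>j. - (transpose A *v (u1 j - A *v w j) + (u2 j - w j))) \<longlonglongrightarrow> - (transpose A *v 0 + 0)"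
    by (intro tendsto_intros tendsto_matrix_vector_mul u1_minus_Aw u2_minus_w)
  ultimately show ?thesis by simp
qed

lemma eps_inner: "eps j \<bullet> h = r j \<bullet> h - \<tau> * (1 \<bullet> h) - g j \<bullet> (A *v h)"
proof -
  have "(transpose A *v g j) \<bullet> h = g j \<bullet> (A *v h)"
    using inner_matrix_vector_mul[of A h "g j"] by (simp only: inner_commute)
  then show ?thesis
    by (simp add: eps_def inner_diff_left del: transpose_matrix_vector)
qed

text \<open>Pairing the normal equation with a kernel direction of \<open>A\<close> removes
  everything behind \<open>transpose A\<close>, including the possibly unbounded \<open>g\<close>.
  The identity is exact, and it is an implicit step: the multiplier on the right belongs to the new
  iterate.\<close>

lemma u2_increment:
  assumes "A *v h = 0"
  shows "(u2 (Suc j) - u2 j) \<bullet> h = r (Suc j) \<bullet> h - \<tau> * (1 \<bullet> h)"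
proof -
  have "h \<bullet> (transpose A *v z) = 0" for z
    using assms by (simp add: inner_matrix_vector_mul[symmetric] del: transpose_matrix_vector)
  moreover have "h \<bullet> (transpose A *v (A *v w j - (u1 j - g j))) + h \<bullet> (w j - (u2 j + r j - \<tau> *\<^sub>R 1)) = 0"
    by (metis normal_equation inner_add_right inner_zero_right)
  ultimately have "h \<bullet> w j = h \<bullet> (u2 j + r j - \<tau> *\<^sub>R 1)"
    by (simp add: inner_diff_right del: transpose_matrix_vector)
  moreover have "snd (S (Suc j)) = snd (S j) - u2 j + w j"
    using arg_cong[OF S_step[of j], of snd] by (simp add: algebra_simps)
  then have "r (Suc j) - \<tau> *\<^sub>R 1 = u2 (Suc j) - (u2 j + \<tau> *\<^sub>R 1 - r j - u2 j + w j)"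
    by (simp add: S_eq algebra_simps)
  then have "h \<bullet> (r (Suc j) - \<tau> *\<^sub>R 1) = h \<bullet> (u2 (Suc j) - (u2 j + \<tau> *\<^sub>R 1 - r j - u2 j + w j))"
    by (rule arg_cong)
  ultimately show ?thesis
    by (simp add: inner_simps inner_commute)
qed

section \<open>Bounded orbits: zero threshold and strictly feasible points\<close>

lemma bounded_orbit_limit:
  assumes "bounded (range S)"
  shows "\<exists>xs. u2 \<longlonglongrightarrow> xs \<and> cbpdn_feasible A y \<delta> xs
    \<and> (\<forall>z. cbpdn_feasible A y \<delta> z \<longrightarrow> \<tau> * (1 \<bullet> xs) \<le> \<tau> * (1 \<bullet> z))"
proof -
  obtain f where f: "dr_step A y \<delta> \<tau> f = f" "S \<longlonglongrightarrow> f"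
    using firmly_nonexpansive_bounded_orbit_converges[where T = "dr_step A y \<delta> \<tau>" and S = S]
      firmly_nonexpansive_dr_step[OF delta_nonneg tau_nonneg] orbit asymptotically_regular assms by blast
  have "u2 \<longlonglongrightarrow> snd (prox y \<delta> \<tau> f)"
    unfolding u2_def prox_def snd_conv pos_part_soft[OF tau_nonneg]
    by (intro tendsto_vec_lambda tendsto_intros f(2))
  then show ?thesis
    using dr_step_fixed_point_optimal[OF delta_nonneg tau_nonneg f(1)] by blast
qed

lemma zero_threshold_limit:
  assumes "\<tau> = 0"
  shows "\<exists>xs. u2 \<longlonglongrightarrow> xs \<and> cbpdn_feasible A y \<delta> xs"
proof -
  obtain z where z: "cbpdn_feasible A y \<delta> z" using feasible by blast
  define f where "f = (A *v z, z)"
  have f: "dr_step A y \<delta> \<tau> f = f"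
    using dr_step_zero_threshold_fixed_point[OF delta_nonneg z] by (simp add: f_def assms)
  have "norm (S j - f) \<le> norm (S 0 - f)" for j
  proof (induction j)
    case (Suc j)
    then show ?case
      using firmly_nonexpansive_imp_nonexpansive[OF
          firmly_nonexpansive_dr_step[OF delta_nonneg tau_nonneg], of A y "S j" f]
      by (simp add: orbit f)
  qed simp
  then have "norm (S j) \<le> norm (S 0 - f) + norm f" for j
    by (smt (verit) norm_triangle_sub)
  then have "bounded (range S)" by (auto simp: bounded_iff)
  then show ?thesis using bounded_orbit_limit by blast
qed

text \<open>If the iterates were unbounded, their normalized limit \<open>v\<close> would be a unit
  vector in the orthant with \<open>A *v v = 0\<close>, since \<open>u1\<close> stays in the ball.
  Complementarity makes \<open>r\<close> vanish eventually on the support of \<open>v\<close>, so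
  pairing \<open>eps\<close> with \<open>v\<close> gives
  \<open>- (\<tau> * (1 \<bullet> v))\<close>. This tends to zero, contradicting
  \<open>v \<noteq> 0\<close>.\<close>

lemma bounded_u2:
  assumes "\<tau> > 0"
  shows "bounded (range u2)"
proof (rule ccontr)
  assume unb: "\<not> bounded (range u2)"
  have "\<exists>j\<ge>N. norm (u2 j) > real N" for N
  proof (rule ccontr)
    assume "\<not> ?thesis"
    then have "\<forall>\<^sub>F j in sequentially. norm (u2 j) \<le> real N"
      by (auto simp: eventually_sequentially not_less)
    then have "Bseq u2" by (rule BfunI)
    then show False using unb by (simp add: Bseq_eq_bounded)
  qed
  then obtain \<sigma> where \<sigma>: "\<And>N. \<sigma> N \<ge> N" "\<And>N. norm (u2 (\<sigma> N)) > real N" by metis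
  define V where "V N = u2 (\<sigma> N) /\<^sub>R norm (u2 (\<sigma> N))" for N
  have V_norm: "norm (V N) = 1" for N
  proof -
    have "norm (u2 (\<sigma> N)) \<noteq> 0" using \<sigma>(2)[of N] by auto
    then show ?thesis by (simp add: V_def)
  qed
  then have "bounded (range V)" by (auto simp: bounded_iff)
  then obtain v \<rho> where \<rho>: "strict_mono \<rho>" and v: "(V \<circ> \<rho>) \<longlonglongrightarrow> v"
    using bounded_imp_convergent_subsequence by blast
  \<comment> \<open>The indices \<sigma> need not increase strictly;
    \<open>\<sigma> N \<ge> N\<close> suffices for \<kappa> to tend to infinity.\<close>
  define \<kappa> where "\<kappa> = \<sigma> \<circ> \<rho>"
  have "filterlim \<rho> at_top sequentially" using \<rho> by (rule filterlim_subseq)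
  moreover have "filterlim \<sigma> at_top sequentially"
    by (rule filterlim_at_top_mono[OF filterlim_ident]) (simp add: \<sigma>(1))
  ultimately have \<kappa>: "filterlim \<kappa> at_top sequentially"
    unfolding \<kappa>_def comp_def by (intro filterlim_compose[of \<sigma> at_top sequentially \<rho> sequentially])
  have norm_top: "filterlim (\<lambda>i. norm (u2 (\<kappa> i))) at_top sequentially"
  proof (rule filterlim_at_top_mono[OF filterlim_real_sequentially])
    have "real i \<le> norm (u2 (\<kappa> i))" for i
      using \<sigma>(2)[of "\<rho> i"] seq_suble[OF \<rho>, of i] unfolding \<kappa>_def o_def
      by (meson less_imp_le of_nat_mono order_trans)
    then show "\<forall>\<^sub>F i in sequentially. real i \<le> norm (u2 (\<kappa> i))" by simp
  qed
  have inv0: "(\<lambda>i. inverse (norm (u2 (\<kappa> i)))) \<longlonglongrightarrow> 0"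
    by (rule tendsto_inverse_0_at_top[OF norm_top])
  have v': "(\<lambda>i. u2 (\<kappa> i) /\<^sub>R norm (u2 (\<kappa> i))) \<longlonglongrightarrow> v"
    using v by (simp add: V_def \<kappa>_def o_def)
  have "norm v = 1"
    using tendsto_norm[OF v] V_norm by (simp add: o_def LIMSEQ_const_iff)
  have v_orthant: "v \<in> nonneg_orthant"
  proof (rule Lim_in_closed_set[OF closed_nonneg_orthant _ _ v'])
    show "\<forall>\<^sub>F i in sequentially. u2 (\<kappa> i) /\<^sub>R norm (u2 (\<kappa> i)) \<in> nonneg_orthant"
      by (simp add: nonneg_orthant_def u2_nonneg)
  qed simp
  have "A *v v = 0"
  proof -
    have "(\<lambda>i. inverse (norm (u2 (\<kappa> i))) *\<^sub>R u1 (\<kappa> i)) \<longlonglongrightarrow> 0"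
      by (rule lim_null_scaleR_bounded[OF inv0, where B = "norm y + \<delta>"]) (simp add: norm_u1_le)
    then have "(\<lambda>i. inverse (norm (u2 (\<kappa> i))) *\<^sub>R (A *v u2 (\<kappa> i) - u1 (\<kappa> i))
        + inverse (norm (u2 (\<kappa> i))) *\<^sub>R u1 (\<kappa> i)) \<longlonglongrightarrow> 0 *\<^sub>R 0 + 0"
      by (intro tendsto_intros inv0 filterlim_compose[OF Au2_minus_u1 \<kappa>])
    moreover have "(\<lambda>i. inverse (norm (u2 (\<kappa> i))) *\<^sub>R (A *v u2 (\<kappa> i))) \<longlonglongrightarrow> A *v v"
      using tendsto_matrix_vector_mul[OF v', of A] by (simp add: matrix_vector_mult_scaleR)
    ultimately show ?thesis
      by (simp add: scaleR_diff_right LIMSEQ_unique)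
  qed
  have "\<forall>\<^sub>F i in sequentially. r (\<kappa> i) $ k * v $ k = 0" for k
  proof (cases "v $ k = 0")
    case False
    then have "v $ k > 0" using v_orthant by (simp add: nonneg_orthant_def order_less_le)
    then have "\<forall>\<^sub>F i in sequentially. (u2 (\<kappa> i) /\<^sub>R norm (u2 (\<kappa> i))) $ k > 0"
      by (rule order_tendstoD(1)[OF tendsto_vec_nth[OF v']])
    then show ?thesis
    proof eventually_elim
      case (elim i)
      then have "u2 (\<kappa> i) $ k > 0" by (simp add: zero_less_mult_iff)
      then show ?case by (simp add: r_eq_0)
    qed
  qed simp
  then have "\<forall>\<^sub>F i in sequentially. \<forall>k. r (\<kappa> i) $ k * v $ k = 0"
    by (rule eventually_all_finite)
  then have "\<forall>\<^sub>F i in sequentially. eps (\<kappa> i) \<bullet> v = - (\<tau> * (1 \<bullet> v))"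
  proof eventually_elim
    case (elim i)
    have "r (\<kappa> i) \<bullet> v = 0"
      unfolding inner_vec_def using elim by (intro sum.neutral) simp
    then show ?case by (simp add: eps_inner \<open>A *v v = 0\<close>)
  qed
  moreover have "(\<lambda>i. eps (\<kappa> i) \<bullet> v) \<longlonglongrightarrow> 0 \<bullet> v"
    by (intro tendsto_intros filterlim_compose[OF eps_tendsto_0 \<kappa>])
  ultimately have "(\<lambda>i. - (\<tau> * (1 \<bullet> v))) \<longlonglongrightarrow> 0 \<bullet> v"
    by (rule Lim_transform_eventually[rotated])
  then have "1 \<bullet> v = 0" using \<open>\<tau> > 0\<close> by (simp add: LIMSEQ_const_iff)
  then show False
    using norm_le_l1_norm[of v] l1_norm_orthant[OF v_orthant] \<open>norm v = 1\<close> by simp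
qed

text \<open>A strictly feasible point bounds the multipliers \<open>g\<close>: pairing
  \<open>r j \<ge> 0\<close> with \<open>x0 - u2 j\<close> bounds \<open>\<eta> * norm (g j)\<close>
  up to small errors. With \<open>u1\<close>, \<open>u2\<close> and \<open>eps\<close> under
  control, \<open>S\<close> is bounded as well.\<close>

lemma slater_limit:
  assumes "\<tau> > 0" and x0: "x0 \<in> nonneg_orthant" "norm (A *v x0 - y) < \<delta>"
  shows "\<exists>xs. u2 \<longlonglongrightarrow> xs \<and> cbpdn_feasible A y \<delta> xs
    \<and> (\<forall>z. cbpdn_feasible A y \<delta> z \<longrightarrow> \<tau> * (1 \<bullet> xs) \<le> \<tau> * (1 \<bullet> z))"
proof -
  define \<eta> where "\<eta> = \<delta> - norm (A *v x0 - y)"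
  have "\<eta> > 0" using x0 by (simp add: \<eta>_def)
  have slope: "g j \<bullet> (A *v x0 - u1 j) \<le> - (\<eta> * norm (g j))" for j
  proof (cases "g j = 0")
    case False
    \<comment> \<open>From \<open>A *v x0\<close> a step of length \<eta> in the direction of
      \<open>g j\<close> stays in the ball; testing the normal \<open>g j\<close> at its end point
      gives the slope.\<close>
    define q where "q = A *v x0 + (\<eta> / norm (g j)) *\<^sub>R g j"
    have "norm (q - y) \<le> norm (A *v x0 - y) + norm ((\<eta> / norm (g j)) *\<^sub>R g j)"
      using norm_triangle_ineq[of "A *v x0 - y" "(\<eta> / norm (g j)) *\<^sub>R g j"]
      by (simp only: q_def add_diff_eq diff_add_eq)
    also have "\<dots> = \<delta>" using False \<open>\<eta> > 0\<close> by (simp add: \<eta>_def)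
    finally have "g j \<bullet> (q - u1 j) \<le> 0"
      by (intro g_normal) (simp add: dist_norm norm_minus_commute)
    then show ?thesis
      using False by (simp add: q_def inner_simps power2_norm_eq_inner[symmetric] power2_eq_square)
  qed simp
  obtain K where K: "\<And>j. norm (u2 j) \<le> K"
    using bounded_u2[OF assms(1)] by (auto simp: bounded_iff)
  define M where "M = (1 + \<tau> * norm (1 :: real^'n)) * (norm x0 + K)"
  have M_bound: "norm (g j) \<le> 2 * M / \<eta>"
    if j: "norm (eps j) \<le> 1" "norm (A *v u2 j - u1 j) \<le> \<eta> / 2" for j
  proof -
    have "0 \<le> r j \<bullet> x0"
      using x0(1) by (intro inner_nonneg_orthant) (simp_all add: nonneg_orthant_def r_nonneg)
    then have "0 \<le> r j \<bullet> (x0 - u2 j)" by (simp add: inner_diff_right r_inner_u2)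
    also have "\<dots> = eps j \<bullet> (x0 - u2 j) + \<tau> * (1 \<bullet> (x0 - u2 j))
        + (g j \<bullet> (A *v x0 - u1 j) - g j \<bullet> (A *v u2 j - u1 j))"
      by (simp add: eps_inner matrix_vector_mult_diff_distrib inner_diff_right algebra_simps)
    finally have "\<eta> * norm (g j) \<le> eps j \<bullet> (x0 - u2 j) + \<tau> * (1 \<bullet> (x0 - u2 j)) - g j \<bullet> (A *v u2 j - u1 j)"
      using slope[of j] by linarith
    \<comment> \<open>This error uses up half of \<open>\<eta> * norm (g j)\<close>; hence the
      tolerance \<open>\<eta> / 2\<close> and the factor 2 in the final bound.\<close>
    moreover have "- (g j \<bullet> (A *v u2 j - u1 j)) \<le> norm (g j) * (\<eta> / 2)"
      using Cauchy_Schwarz_ineq2[of "g j" "A *v u2 j - u1 j"]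
        mult_left_mono[OF j(2) norm_ge_zero[of "g j"]] by linarith
    moreover have "eps j \<bullet> (x0 - u2 j) + \<tau> * (1 \<bullet> (x0 - u2 j)) \<le> M"
    proof -
      have d: "norm (x0 - u2 j) \<le> norm x0 + K"
        using norm_triangle_ineq4[of x0 "u2 j"] K[of j] by linarith
      have "eps j \<bullet> (x0 - u2 j) \<le> 1 * (norm x0 + K)"
        by (rule order_trans[OF norm_cauchy_schwarz mult_mono[OF j(1) d]]) simp_all
      moreover have "1 \<bullet> (x0 - u2 j) \<le> norm (1 :: real^'n) * (norm x0 + K)"
        by (rule order_trans[OF norm_cauchy_schwarz mult_left_mono[OF d]]) simp
      then have "\<tau> * (1 \<bullet> (x0 - u2 j)) \<le> \<tau> * (norm (1 :: real^'n) * (norm x0 + K))"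
        using \<open>\<tau> > 0\<close> by (intro mult_left_mono) simp_all
      ultimately show ?thesis by (simp add: M_def algebra_simps)
    qed
    ultimately have "norm (g j) * (\<eta> / 2) \<le> M" by (simp add: algebra_simps)
    then show ?thesis using \<open>\<eta> > 0\<close> by (simp add: field_simps)
  qed
  obtain B where B: "\<And>v. norm (transpose A *v v) \<le> norm v * B" "B \<ge> 0"
    using bounded_linear.nonneg_bounded[OF matrix_vector_mul_bounded_linear[of "transpose A"]] by blast
  have "\<forall>\<^sub>F j in sequentially. norm (eps j) < 1" "\<forall>\<^sub>F j in sequentially. norm (A *v u2 j - u1 j) < \<eta> / 2"
    using tendstoD[OF eps_tendsto_0, of 1] tendstoD[OF Au2_minus_u1, of "\<eta> / 2"] \<open>\<eta> > 0\<close> by simp_all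
  then have "\<forall>\<^sub>F j in sequentially. norm (g j) \<le> 2 * M / \<eta> \<and> norm (S j)
      \<le> norm y + \<delta> + 2 * M / \<eta> + (norm (transpose A *v g j) + K + 1)"
  proof eventually_elim
    case (elim j)
    have g: "norm (g j) \<le> 2 * M / \<eta>" using M_bound[of j] elim by simp
    have snd_S: "snd (S j) = u2 j - eps j - transpose A *v g j" by (simp add: eps_def r_def)
    have "norm (snd (S j)) \<le> norm (transpose A *v g j) + K + 1"
      unfolding snd_S using norm_triangle_ineq4[of "u2 j - eps j" "transpose A *v g j"] norm_triangle_ineq4[of "u2 j" "eps j"]
        K[of j] elim by linarith
    moreover have "norm (fst (S j)) \<le> norm y + \<delta> + 2 * M / \<eta>"
      using norm_triangle_ineq[of "u1 j" "g j"] norm_u1_le[of j] g by (simp add: S_eq)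
    moreover have "norm (S j) \<le> norm (fst (S j)) + norm (snd (S j))"
      using norm_Pair_le[of "fst (S j)" "snd (S j)"] by simp
    ultimately show ?case using g by linarith
  qed
  then have "\<forall>\<^sub>F j in sequentially. norm (S j)
      \<le> norm y + \<delta> + 2 * M / \<eta> + (2 * M / \<eta> * B + K + 1)"
  proof eventually_elim
    case (elim j)
    show ?case
      using elim B(1)[of "g j"] mult_right_mono[OF conjunct1[OF elim] B(2)] by linarith
  qed
  then have "Bseq S" by (rule BfunI)
  then show ?thesis by (intro bounded_orbit_limit) (simp add: Bseq_eq_bounded)
qed

section \<open>Limit points and the degenerate case\<close>

lemma subsequential_limit_feasible:
  assumes \<kappa>: "strict_mono \<kappa>" and lim: "(u2 \<circ> \<kappa>) \<longlonglongrightarrow> l"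
  shows "cbpdn_feasible A y \<delta> l"
proof -
  have \<kappa>': "filterlim \<kappa> at_top sequentially" using \<kappa> by (rule filterlim_subseq)
  have lim': "(\<lambda>i. u2 (\<kappa> i)) \<longlonglongrightarrow> l" using lim by (simp add: o_def)
  have "(\<lambda>i. A *v u2 (\<kappa> i) - (A *v u2 (\<kappa> i) - u1 (\<kappa> i))) \<longlonglongrightarrow> A *v l - 0"
    by (intro tendsto_diff tendsto_matrix_vector_mul lim' filterlim_compose[OF Au2_minus_u1 \<kappa>'])
  then have "(\<lambda>i. u1 (\<kappa> i)) \<longlonglongrightarrow> A *v l" by simp
  then have "A *v l \<in> cball y \<delta>"
    by (rule Lim_in_closed_set[OF closed_cball, rotated 2]) (use u1_in_cball in auto)
  moreover have "l \<in> nonneg_orthant"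
    by (rule Lim_in_closed_set[OF closed_nonneg_orthant _ _ lim']) (use u2_in_orthant in auto)
  ultimately show ?thesis by (simp add: cbpdn_feasible_def dist_norm norm_minus_commute)
qed

text \<open>Since \<open>z\<close> and \<open>l\<close> have the same image, \<open>g\<close> drops
  out of the pairing of \<open>eps\<close> with \<open>z - l\<close>. The pairing with
  \<open>r\<close> is eventually nonnegative: where \<open>l\<close> is zero both factors are
  nonnegative, and where \<open>l\<close> is positive \<open>r\<close> eventually vanishes.\<close>

lemma subsequential_limit_optimal:
  assumes \<kappa>: "strict_mono \<kappa>" and lim: "(u2 \<circ> \<kappa>) \<longlonglongrightarrow> l"
    and z: "z \<in> nonneg_orthant" "A *v z = A *v l"
  shows "\<tau> * (1 \<bullet> l) \<le> \<tau> * (1 \<bullet> z)"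
proof -
  have \<kappa>': "filterlim \<kappa> at_top sequentially" using \<kappa> by (rule filterlim_subseq)
  have lim': "(\<lambda>i. u2 (\<kappa> i)) \<longlonglongrightarrow> l" using lim by (simp add: o_def)
  have l: "l \<in> nonneg_orthant"
    using subsequential_limit_feasible[OF \<kappa> lim] by (simp add: cbpdn_feasible_def)
  have "\<forall>\<^sub>F i in sequentially. 0 \<le> r (\<kappa> i) $ k * (z - l) $ k" for k
  proof (cases "l $ k = 0")
    case True
    then show ?thesis using z(1) by (simp add: nonneg_orthant_def r_nonneg)
  next
    case False
    then have "l $ k > 0" using l by (simp add: nonneg_orthant_def order_less_le)
    then have "\<forall>\<^sub>F i in sequentially. u2 (\<kappa> i) $ k > 0"
      by (rule order_tendstoD(1)[OF tendsto_vec_nth[OF lim']])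
    then show ?thesis by eventually_elim (simp add: r_eq_0)
  qed
  then have "\<forall>\<^sub>F i in sequentially. \<forall>k. 0 \<le> r (\<kappa> i) $ k * (z - l) $ k"
    by (rule eventually_all_finite)
  then have ev: "\<forall>\<^sub>F i in sequentially. - (\<tau> * (1 \<bullet> (z - l))) \<le> eps (\<kappa> i) \<bullet> (z - l)"
  proof eventually_elim
    case (elim i)
    have "0 \<le> r (\<kappa> i) \<bullet> (z - l)"
      unfolding inner_vec_def using elim by (intro sum_nonneg) simp
    then show ?case by (simp add: eps_inner matrix_vector_mult_diff_distrib z(2))
  qed
  have lim_eps: "(\<lambda>i. eps (\<kappa> i) \<bullet> (z - l)) \<longlonglongrightarrow> 0 \<bullet> (z - l)"
    by (intro tendsto_intros filterlim_compose[OF eps_tendsto_0 \<kappa>'])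
  show ?thesis
    using tendsto_lowerbound[OF lim_eps ev] by (simp add: inner_diff_right algebra_simps)
qed

text \<open>The shadow sequence moves inside the optimal face only through the multipliers \<open>r\<close>, and
  \<open>r $ i\<close> vanishes unless the sequence touches the wall \<open>i\<close>. Hence each move of the face component
  goes towards the relative interior point \<open>l\<close>, by an amount that its distance to \<open>l\<close> pays for.\<close>

lemma face_multipliers_summable:
  assumes Al: "\<And>z. z \<in> \<Phi> \<Longrightarrow> A *v z = A *v l" and one: "\<And>z. z \<in> \<Phi> \<Longrightarrow> 1 \<bullet> z = 1 \<bullet> l"
    and l: "l \<in> nonneg_orthant" and supp: "\<And>z i. z \<in> \<Phi> \<Longrightarrow> l $ i = 0 \<Longrightarrow> z $ i = 0"
    and near: "\<And>e. e > 0 \<Longrightarrow> \<forall>\<^sub>F j in sequentially. \<exists>\<phi>\<in>\<Phi>. dist (u2 j) \<phi> < e"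
  shows "summable (\<lambda>j. \<Sum>i | l $ i \<noteq> 0. r j $ i)"
proof -
  define I where "I = {i. l $ i \<noteq> 0}"
  \<comment> \<open>A space containing all directions from \<open>l\<close> to points of \<Phi>.
    Below, \<open>p j\<close> is the orthogonal projection of \<open>u2 j - l\<close> onto it, the
    face component.\<close>
  define Y where "Y = {h. A *v h = 0 \<and> 1 \<bullet> h = 0 \<and> (\<forall>i. l $ i = 0 \<longrightarrow> h $ i = 0)}"
  have Y: "subspace Y"
    by (auto simp: Y_def subspace_def inner_add_right matrix_vector_right_distrib matrix_vector_mult_scaleR)
  have "\<exists>p\<in>Y. \<forall>h\<in>Y. (u2 j - l - p) \<bullet> h = 0" for j
  proof -
    obtain p z where "p \<in> span Y" "\<And>h. h \<in> span Y \<Longrightarrow> orthogonal z h" "u2 j - l = p + z"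
      using orthogonal_subspace_decomp_exists[of Y "u2 j - l"] by metis
    then show ?thesis
      using Y by (intro bexI[of _ p]) (auto simp: orthogonal_def span_eq_iff[THEN iffD2, OF Y])
  qed
  then obtain p where pY: "\<And>j. p j \<in> Y" and orth: "\<And>j h. h \<in> Y \<Longrightarrow> (u2 j - l - p j) \<bullet> h = 0"
    by metis
  have off_face: "norm (u2 j - l - p j) \<le> dist (u2 j) \<phi>" if "\<phi> \<in> \<Phi>" for j \<phi>
  proof -
    define h where "h = p j - (\<phi> - l)"
    have "\<phi> - l \<in> Y"
      using that by (auto simp: Y_def matrix_vector_mult_diff_distrib inner_diff_right Al one supp)
    then have "h \<in> Y" unfolding h_def by (rule subspace_diff[OF Y pY])
    then have "(norm ((u2 j - l - p j) + h))\<^sup>2 = (norm (u2 j - l - p j))\<^sup>2 + (norm h)\<^sup>2"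
      by (intro norm_add_Pythagorean) (simp add: orthogonal_def orth)
    moreover have "(u2 j - l - p j) + h = u2 j - \<phi>" by (simp add: h_def)
    ultimately have "(norm (u2 j - l - p j))\<^sup>2 \<le> (norm (u2 j - \<phi>))\<^sup>2" by simp
    then show ?thesis by (simp add: dist_norm)
  qed
  have R_nonneg: "0 \<le> (\<Sum>i\<in>I. r j $ i)" for j by (simp add: sum_nonneg r_nonneg)
  obtain m where m: "m > 0" "\<And>i. i \<in> I \<Longrightarrow> m \<le> l $ i"
  proof (cases "I = {}")
    case True then show thesis using that[of 1] by simp
  next
    case False
    have "0 < l $ i" if "i \<in> I" for i
      using that l by (simp add: I_def nonneg_orthant_def order_less_le)
    then have "0 < Min ((\<lambda>i. l $ i) ` I)" using False by (subst Min_gr_iff) auto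
    then show thesis using that[of "Min ((\<lambda>i. l $ i) ` I)"] by auto
  qed
  have descent: "m * (\<Sum>i\<in>I. r (Suc j) $ i) \<le> (norm (p j))\<^sup>2 - (norm (p (Suc j)))\<^sup>2"
    if near_face: "norm (u2 (Suc j) - l - p (Suc j)) \<le> m / 2" for j
  proof -
    let ?p = "p (Suc j)"
    \<comment> \<open>The parts orthogonal to \<open>Y\<close> cancel, so the exact increment
      formula applies. Because the step is implicit, the quadratic remainder
      \<open>(norm (p j - ?p))\<^sup>2\<close> has the favourable sign.\<close>
    have "(p j - ?p) \<bullet> ?p = (u2 j - u2 (Suc j)) \<bullet> ?p"
      using orth[OF pY, of j "Suc j"] orth[OF pY, of "Suc j" "Suc j"]
      by (simp add: inner_diff_left)
    also have "\<dots> = - (r (Suc j) \<bullet> ?p)"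
      using u2_increment[of ?p j] pY[of "Suc j"] by (simp add: Y_def inner_diff_left)
    finally have "2 * (- (r (Suc j) \<bullet> ?p)) \<le> (norm (p j))\<^sup>2 - (norm ?p)\<^sup>2"
      using zero_le_power2[of "norm (p j - ?p)"]
      by (simp add: power2_norm_eq_inner inner_simps inner_commute)
    moreover have "r (Suc j) \<bullet> ?p \<le> - (m / 2 * (\<Sum>i\<in>I. r (Suc j) $ i))"
    proof -
      have "r (Suc j) \<bullet> ?p = (\<Sum>i\<in>I. r (Suc j) $ i * ?p $ i)"
        unfolding inner_vec_def inner_real_def using pY[of "Suc j"]
        by (intro sum.mono_neutral_right) (auto simp: I_def Y_def)
      also have "\<dots> \<le> (\<Sum>i\<in>I. - (m / 2 * r (Suc j) $ i))"
      proof (rule sum_mono)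
        fix i assume i: "i \<in> I"
        show "r (Suc j) $ i * ?p $ i \<le> - (m / 2 * r (Suc j) $ i)"
        proof (cases "r (Suc j) $ i = 0")
          case False
          then have u0: "u2 (Suc j) $ i = 0" using r_complementary[of "Suc j" i] by simp
          \<comment> \<open>At a wall with active multiplier the iterate has coordinate zero, so its
            face component is within \<open>m / 2\<close> of \<open>- l $ i\<close>, which is at
            most \<open>- m\<close>.\<close>
          have "\<bar>(u2 (Suc j) - l - ?p) $ i\<bar> \<le> m / 2"
            using component_le_norm_cart[of "u2 (Suc j) - l - ?p" i] near_face by linarith
          moreover have "(u2 (Suc j) - l - ?p) $ i = - l $ i - ?p $ i" by (simp add: u0)
          ultimately have "?p $ i \<le> - (m / 2)" using m(2)[OF i] by linarith
          then show ?thesis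
            using mult_left_mono[OF _ r_nonneg, of "?p $ i" "- (m / 2)" "Suc j" i] by (simp add: mult.commute)
        qed simp
      qed
      finally show ?thesis by (simp add: sum_negf sum_distrib_left)
    qed
    ultimately show ?thesis by simp
  qed
  obtain N where N: "\<And>j. j \<ge> N \<Longrightarrow> \<exists>\<phi>\<in>\<Phi>. dist (u2 j) \<phi> < m / 2"
    using near[of "m / 2"] \<open>m > 0\<close> unfolding eventually_sequentially by (meson half_gt_zero)
  have step: "m * (\<Sum>i\<in>I. r (Suc j) $ i) \<le> (norm (p j))\<^sup>2 - (norm (p (Suc j)))\<^sup>2" if "j \<ge> N" for j
  proof -
    obtain \<phi> where "\<phi> \<in> \<Phi>" "dist (u2 (Suc j)) \<phi> < m / 2" using N[of "Suc j"] \<open>j \<ge> N\<close> by auto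
    then show ?thesis using off_face[of \<phi> "Suc j"] by (intro descent) linarith
  qed
  have "(\<Sum>j<n. m * (\<Sum>i\<in>I. r (Suc (j + N)) $ i)) \<le> (norm (p N))\<^sup>2 - (norm (p (n + N)))\<^sup>2" for n
  proof (induction n)
    case (Suc n) then show ?case using step[of "n + N"] by simp
  qed simp
  then have "(\<Sum>j<n. m * (\<Sum>i\<in>I. r (Suc (j + N)) $ i)) \<le> (norm (p N))\<^sup>2" for n
    by (rule order_trans) simp
  then have "summable (\<lambda>j. m * (\<Sum>i\<in>I. r (Suc (j + N)) $ i))"
    using R_nonneg \<open>m > 0\<close> by (intro summableI_nonneg_bounded) auto
  then have "summable (\<lambda>j. \<Sum>i\<in>I. r (j + Suc N) $ i)"
    using \<open>m > 0\<close> by (simp add: summable_cmult_iff)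
  then have "summable (\<lambda>j. \<Sum>i\<in>I. r j $ i)"
    by (subst (asm) summable_iff_shift)
  then show ?thesis by (simp add: I_def)
qed

text \<open>As all feasible points share one image, every limit point is compared with all of them
  and lies in the optimal face \<Phi>. Summable multipliers make
  \<open>u2 j \<bullet> (c - xs)\<close> converge for each \<open>c\<close> in \<Phi>; evaluating
  this limit along subsequences tending to \<open>c\<close> and to \<open>xs\<close> forces
  \<open>c = xs\<close>.\<close>

lemma degenerate_limit:
  assumes "\<tau> > 0" and same: "\<And>z z'. cbpdn_feasible A y \<delta> z \<Longrightarrow> cbpdn_feasible A y \<delta> z' \<Longrightarrow> A *v z = A *v z'"
  shows "\<exists>xs. u2 \<longlonglongrightarrow> xs \<and> cbpdn_feasible A y \<delta> xs
    \<and> (\<forall>z. cbpdn_feasible A y \<delta> z \<longrightarrow> \<tau> * (1 \<bullet> xs) \<le> \<tau> * (1 \<bullet> z))"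
proof -
  define \<Phi> where "\<Phi> = {x. cbpdn_feasible A y \<delta> x \<and> (\<forall>z. cbpdn_feasible A y \<delta> z \<longrightarrow> 1 \<bullet> x \<le> 1 \<bullet> z)}"
  note bdd = bounded_u2[OF assms(1)]
  have lim_\<Phi>: "c \<in> \<Phi>" if "strict_mono \<kappa>" "(u2 \<circ> \<kappa>) \<longlonglongrightarrow> c" for \<kappa> c
  proof -
    have c: "cbpdn_feasible A y \<delta> c" using subsequential_limit_feasible[OF that] .
    have "1 \<bullet> c \<le> 1 \<bullet> z" if z: "cbpdn_feasible A y \<delta> z" for z
      using subsequential_limit_optimal[OF \<open>strict_mono \<kappa>\<close> \<open>(u2 \<circ> \<kappa>) \<longlonglongrightarrow> c\<close> _ same[OF z c]] z \<open>\<tau> > 0\<close>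
      by (simp add: cbpdn_feasible_def)
    then show ?thesis using c by (simp add: \<Phi>_def)
  qed
  obtain xs \<rho> where \<rho>: "strict_mono \<rho>" "(u2 \<circ> \<rho>) \<longlonglongrightarrow> xs"
    using bounded_imp_convergent_subsequence[OF bdd] by auto
  have xs: "xs \<in> \<Phi>" using lim_\<Phi>[OF \<rho>] .
  define supp where "supp x = {i. x $ i \<noteq> 0}" for x :: "real^'n"
  \<comment> \<open>A point of largest support serves as relative interior point of the face: if
    some \<open>z\<close> in \<Phi> had a further nonzero coordinate, the midpoint of
    \<open>l\<close> and \<open>z\<close> would have larger support.\<close>
  obtain l where l: "l \<in> \<Phi>" and l_max: "\<And>z. z \<in> \<Phi> \<Longrightarrow> card (supp z) \<le> card (supp l)"
    using ex_has_greatest_nat[of "\<lambda>x. x \<in> \<Phi>" xs "\<lambda>x. card (supp x)" "Suc CARD('n)"] xs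
    by (auto simp: less_Suc_eq_le card_mono)
  have l_orthant: "l \<in> nonneg_orthant" using l by (simp add: \<Phi>_def cbpdn_feasible_def)
  have Al: "A *v z = A *v l" if "z \<in> \<Phi>" for z using that l by (auto simp: \<Phi>_def intro: same)
  have one: "1 \<bullet> z = 1 \<bullet> l" if "z \<in> \<Phi>" for z using that l by (auto simp: \<Phi>_def intro: order_antisym)
  have supp_l: "z $ i = 0" if z: "z \<in> \<Phi>" and i: "l $ i = 0" for z i
  proof (rule ccontr)
    assume zi: "z $ i \<noteq> 0"
    define c where "c = (1 / 2) *\<^sub>R l + (1 / 2) *\<^sub>R z"
    have z_orthant: "z \<in> nonneg_orthant" using z by (simp add: \<Phi>_def cbpdn_feasible_def)
    have "A *v c = A *v l"
      by (simp add: c_def matrix_vector_right_distrib matrix_vector_mult_scaleR Al[OF z]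
          scaleR_left_distrib[symmetric])
    moreover have "c \<in> nonneg_orthant"
      using l_orthant z_orthant by (simp add: c_def nonneg_orthant_def)
    ultimately have "cbpdn_feasible A y \<delta> c" using l by (simp add: \<Phi>_def cbpdn_feasible_def)
    moreover have "1 \<bullet> c = 1 \<bullet> l" by (simp add: c_def inner_add_right one[OF z])
    ultimately have "c \<in> \<Phi>" using l by (simp add: \<Phi>_def)
    moreover have "supp l \<subset> supp c"
    proof
      have "0 < c $ k" if "l $ k \<noteq> 0" for k
      proof -
        have "0 < l $ k" "0 \<le> z $ k"
          using that l_orthant z_orthant by (simp_all add: nonneg_orthant_def order_less_le)
        then show ?thesis by (simp add: c_def)
      qed
      then show "supp l \<subseteq> supp c" by (force simp: supp_def)
      have "i \<in> supp c" "i \<notin> supp l" using zi i by (simp_all add: supp_def c_def)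
      then show "supp l \<noteq> supp c" by blast
    qed
    then have "card (supp l) < card (supp c)" by (intro psubset_card_mono) simp_all
    ultimately show False using l_max by fastforce
  qed
  have near: "\<forall>\<^sub>F j in sequentially. \<exists>\<phi>\<in>\<Phi>. dist (u2 j) \<phi> < e" if "e > 0" for e
    using bdd lim_\<Phi> that by (rule eventually_near_subsequential_limits)
  have summ: "summable (\<lambda>j. \<Sum>i | l $ i \<noteq> 0. r j $ i)"
    by (rule face_multipliers_summable[OF Al one l_orthant supp_l near])
  have conv: "convergent (\<lambda>j. u2 j \<bullet> (c - xs))" if c: "c \<in> \<Phi>" for c
  proof (rule convergent_if_increments_summable)
    define h where "h = c - xs"
    have h: "A *v h = 0" "1 \<bullet> h = 0" "\<And>i. l $ i = 0 \<Longrightarrow> h $ i = 0"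
      using Al[OF c] Al[OF xs] one[OF c] one[OF xs] supp_l[OF c] supp_l[OF xs]
      by (simp_all add: h_def matrix_vector_mult_diff_distrib inner_diff_right)
    have incr: "u2 (Suc j) \<bullet> h - u2 j \<bullet> h = r (Suc j) \<bullet> h" for j
      using u2_increment[OF h(1), of j] h(2) by (simp add: inner_diff_left)
    have bound: "norm (r (Suc j) \<bullet> h) \<le> norm h * (\<Sum>i | l $ i \<noteq> 0. r (Suc j) $ i)" for j
    proof -
      have "r (Suc j) \<bullet> h = (\<Sum>i | l $ i \<noteq> 0. r (Suc j) $ i * h $ i)"
        unfolding inner_vec_def inner_real_def using h(3) by (intro sum.mono_neutral_right) auto
      also have "norm \<dots> \<le> (\<Sum>i | l $ i \<noteq> 0. r (Suc j) $ i * norm h)"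
        by (rule order_trans[OF norm_sum])
          (auto simp: abs_mult r_nonneg intro!: sum_mono mult_left_mono component_le_norm_cart)
      finally show ?thesis by (simp add: sum_distrib_left mult.commute)
    qed
    have "summable (\<lambda>j. norm h * (\<Sum>i | l $ i \<noteq> 0. r (Suc j) $ i))"
      by (rule summable_mult) (use summ in \<open>subst summable_Suc_iff\<close>)
    then have "summable (\<lambda>j. r (Suc j) \<bullet> h)"
      by (rule summable_comparison_test'[where N = 0]) (rule bound)
    then show "summable (\<lambda>j. u2 (Suc j) \<bullet> (c - xs) - u2 j \<bullet> (c - xs))"
      using incr by (simp add: h_def)
  qed
  have "u2 \<longlonglongrightarrow> xs"
  proof (rule bounded_unique_subsequential_limit[OF bdd])
    fix \<kappa> c assume \<kappa>: "strict_mono \<kappa>" "(u2 \<circ> \<kappa>) \<longlonglongrightarrow> c"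
    obtain L where L: "(\<lambda>j. u2 j \<bullet> (c - xs)) \<longlonglongrightarrow> L"
      using conv[OF lim_\<Phi>[OF \<kappa>]] by (auto simp: convergent_def)
    have "(\<lambda>i. (u2 \<circ> \<kappa>) i \<bullet> (c - xs)) \<longlonglongrightarrow> c \<bullet> (c - xs)"
      by (intro tendsto_intros \<kappa>(2))
    then have "c \<bullet> (c - xs) = L"
      using LIMSEQ_unique LIMSEQ_subseq_LIMSEQ[OF L \<kappa>(1)] by (simp add: o_def)
    moreover have "(\<lambda>i. (u2 \<circ> \<rho>) i \<bullet> (c - xs)) \<longlonglongrightarrow> xs \<bullet> (c - xs)"
      by (intro tendsto_intros \<rho>(2))
    then have "xs \<bullet> (c - xs) = L"
      using LIMSEQ_unique LIMSEQ_subseq_LIMSEQ[OF L \<rho>(1)] by (simp add: o_def)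
    ultimately have "(c - xs) \<bullet> (c - xs) = 0" by (simp add: inner_diff_left)
    then show "c = xs" by simp
  qed
  then show ?thesis using xs \<open>\<tau> > 0\<close> by (auto simp: \<Phi>_def)
qed

text \<open>Strict convexity of the Euclidean ball: the midpoint residual also has norm at least
  \<delta>, so the parallelogram law leaves no room between the two residuals.\<close>

lemma image_unique_without_slater:
  assumes no_slater: "\<And>x. x \<in> nonneg_orthant \<Longrightarrow> \<delta> \<le> norm (A *v x - y)"
    and z: "cbpdn_feasible A y \<delta> z" and z': "cbpdn_feasible A y \<delta> z'"
  shows "A *v z = A *v z'"
proof -
  define c where "c = (1 / 2) *\<^sub>R z + (1 / 2) *\<^sub>R z'"
  define a b where "a = A *v z - y" and "b = A *v z' - y"
  have "c \<in> nonneg_orthant" using z z' by (simp add: c_def cbpdn_feasible_def nonneg_orthant_def)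
  then have "\<delta> \<le> norm (A *v c - y)" by (rule no_slater)
  moreover have "A *v c - y = (1 / 2) *\<^sub>R (a + b)"
    by (simp add: c_def a_def b_def matrix_vector_right_distrib matrix_vector_mult_scaleR vec_eq_iff field_simps)
  ultimately have "2 * \<delta> \<le> norm (a + b)" by simp
  then have "(2 * \<delta>)\<^sup>2 \<le> (norm (a + b))\<^sup>2" using delta_nonneg by (intro power_mono) simp_all
  moreover have "(norm a)\<^sup>2 \<le> \<delta>\<^sup>2" "(norm b)\<^sup>2 \<le> \<delta>\<^sup>2"
    using z z' by (simp_all add: a_def b_def cbpdn_feasible_def power_mono)
  moreover have "(norm (a - b))\<^sup>2 + (norm (a + b))\<^sup>2 = 2 * (norm a)\<^sup>2 + 2 * (norm b)\<^sup>2"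
    by (simp add: power2_norm_eq_inner inner_simps inner_commute)
  moreover have "(2 * \<delta>)\<^sup>2 = 4 * \<delta>\<^sup>2" by (simp add: power_mult_distrib)
  ultimately have "(norm (a - b))\<^sup>2 \<le> 0" by linarith
  then show ?thesis by (simp add: a_def b_def)
qed

lemma shadow_limit:
  "\<exists>xs. u2 \<longlonglongrightarrow> xs \<and> cbpdn_feasible A y \<delta> xs
    \<and> (\<forall>z. cbpdn_feasible A y \<delta> z \<longrightarrow> \<tau> * (1 \<bullet> xs) \<le> \<tau> * (1 \<bullet> z))"
proof (cases "\<tau> = 0")
  case True
  then show ?thesis using zero_threshold_limit by auto
next
  case False
  then have "\<tau> > 0" using tau_nonneg by simp
  show ?thesis
  proof (cases "\<exists>x\<in>nonneg_orthant. norm (A *v x - y) < \<delta>")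
    case True
    then show ?thesis using slater_limit[OF \<open>\<tau> > 0\<close>] by blast
  next
    case False
    then have "\<And>x. x \<in> nonneg_orthant \<Longrightarrow> \<delta> \<le> norm (A *v x - y)" by (simp add: not_less)
    then show ?thesis
      using degenerate_limit[OF \<open>\<tau> > 0\<close>] image_unique_without_slater by blast
  qed
qed

end

section \<open>C-SUnSAL as an instance of the alternating direction method\<close>

lemma upper_stack [simp]: "upper (stack a b) = a" and lower_stack [simp]: "lower (stack a b) = b"
  by (simp_all add: upper_def lower_def stack_def)

lemma stack_upper_lower [simp]: "stack (upper u) (lower u) = u"
  by (simp add: vec_eq_iff stack_def upper_def lower_def split: sum.split)

lemma stack_eq_iff: "u = stack a b \<longleftrightarrow> upper u = a \<and> lower u = b"
  by (metis upper_stack lower_stack stack_upper_lower)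

lemma stack_diff: "stack a b - stack c d = stack (a - c) (b - d)"
  by (simp add: vec_eq_iff stack_def split: sum.split)

lemma norm_stack:
  fixes a :: "real^'k::finite" and b :: "real^'n::finite"
  shows "(norm (stack a b))\<^sup>2 = (norm a)\<^sup>2 + (norm b)\<^sup>2"
proof -
  have "(\<Sum>i\<in>UNIV. (stack a b $ i)\<^sup>2)
      = (\<Sum>i\<in>UNIV. (a $ i)\<^sup>2) + (\<Sum>i\<in>UNIV. (b $ i)\<^sup>2)"
    unfolding UNIV_Plus_UNIV[symmetric] by (subst sum.Plus) (simp_all add: stack_def)
  then show ?thesis by (simp add: norm_vec_def L2_set_def sum_nonneg)
qed

lemma csunsal_G_mult: "csunsal_G A *v z = stack (A *v z) z"
proof -
  have "(csunsal_G A *v z) $ i = stack (A *v z) z $ i" for i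
  proof (cases i)
    case (Inr b)
    have "(csunsal_G A *v z) $ Inr b = (mat 1 *v z) $ b"
      by (simp add: csunsal_G_def matrix_vector_mult_def stack_def)
    then show ?thesis by (simp add: Inr stack_def)
  qed (simp add: csunsal_G_def matrix_vector_mult_def stack_def)
  then show ?thesis by (simp add: vec_eq_iff)
qed

lemma csunsal_f2_eq:
  "csunsal_f2 y \<delta> lam u =
    (if upper u \<in> cball y \<delta> \<and> lower u \<in> nonneg_orthant then ereal (lam * (1 \<bullet> lower u)) else \<infinity>)"
  by (simp add: csunsal_f2_def ind_fun_def l1_norm_orthant)

lemma cbpdn_objective_eq:
  "cbpdn_objective A y \<delta> x = (if cbpdn_feasible A y \<delta> x then ereal (l1_norm x) else \<infinity>)"
  by (simp add: cbpdn_objective_def ind_fun_def cbpdn_feasible_def dist_norm norm_minus_commute)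

section \<open>Closed forms of the two subproblems\<close>

lemma minimizer_iff_of_strict:
  fixes f :: "'a \<Rightarrow> ereal"
  assumes "\<And>z. z \<noteq> x0 \<Longrightarrow> f x0 < f z"
  shows "minimizer f x \<longleftrightarrow> x = x0"
  using assms unfolding is_arg_min_def by (metis order.asym)

text \<open>Expand both squares around \<open>x0\<close>; the normal equation kills the cross terms.
  The last summand gives strict growth, hence a unique minimizer.\<close>

lemma normal_solve_least_squares:
  fixes A :: "real^'n^'k" and v :: "(real^'k) \<times> (real^'n)"
  defines "x0 \<equiv> normal_solve A v"
  shows "(norm (A *v z - fst v))\<^sup>2 + (norm (z - snd v))\<^sup>2
    = (norm (A *v x0 - fst v))\<^sup>2 + (norm (x0 - snd v))\<^sup>2 + (norm (A *v (z - x0)))\<^sup>2 + (norm (z - x0))\<^sup>2"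
proof -
  define e f h where "e = A *v x0 - fst v" and "f = x0 - snd v" and "h = z - x0"
  have "transpose A *v e + f = 0"
    using normal_solve_iff[of x0 A v] by (simp add: x0_def e_def f_def)
  then have "h \<bullet> (transpose A *v e) + h \<bullet> f = 0" by (metis inner_add_right inner_zero_right)
  then have orth: "(A *v h) \<bullet> e + h \<bullet> f = 0" by (simp add: inner_matrix_vector_mul)
  have "A *v z - fst v = e + A *v h" "z - snd v = f + h"
    by (simp_all add: e_def f_def h_def matrix_vector_mult_diff_distrib)
  then have "(norm (A *v z - fst v))\<^sup>2 + (norm (z - snd v))\<^sup>2
      = (norm e)\<^sup>2 + (norm f)\<^sup>2 + (norm (A *v h))\<^sup>2 + (norm h)\<^sup>2 + 2 * ((A *v h) \<bullet> e + h \<bullet> f)"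
    by (simp only: power2_norm_eq_inner) (simp add: inner_simps inner_commute)
  then show ?thesis by (simp add: orth) (simp add: e_def f_def h_def)
qed

lemma admm_x_step:
  fixes A :: "real^'n^'k"
  assumes "\<mu> > 0"
  shows "minimizer (\<lambda>z. csunsal_f1 z + ereal (\<mu> / 2 * (norm (csunsal_G A *v z - stack u1 u2 - stack d1 d2))\<^sup>2)) x
    \<longleftrightarrow> x = normal_solve A (u1 + d1, u2 + d2)"
proof (rule minimizer_iff_of_strict)
  fix z assume "z \<noteq> normal_solve A (u1 + d1, u2 + d2)"
  then have "(norm (z - normal_solve A (u1 + d1, u2 + d2)))\<^sup>2 > 0" by simp
  then have less: "(norm (A *v normal_solve A (u1 + d1, u2 + d2) - (u1 + d1)))\<^sup>2
      + (norm (normal_solve A (u1 + d1, u2 + d2) - (u2 + d2)))\<^sup>2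
      < (norm (A *v z - (u1 + d1)))\<^sup>2 + (norm (z - (u2 + d2)))\<^sup>2"
    using normal_solve_least_squares[of A z "(u1 + d1, u2 + d2)"]
      zero_le_power2[of "norm (A *v (z - normal_solve A (u1 + d1, u2 + d2)))"]
    unfolding fst_conv snd_conv by linarith
  have "csunsal_f1 z + ereal (\<mu> / 2 * (norm (csunsal_G A *v z - stack u1 u2 - stack d1 d2))\<^sup>2)
      = ereal (\<mu> / 2 * ((norm (A *v z - (u1 + d1)))\<^sup>2 + (norm (z - (u2 + d2)))\<^sup>2))" for z
    by (simp add: csunsal_f1_def csunsal_G_mult stack_diff norm_stack diff_diff_add zero_ereal_def[symmetric])
  then show "csunsal_f1 (normal_solve A (u1 + d1, u2 + d2))
        + ereal (\<mu> / 2 * (norm (csunsal_G A *v normal_solve A (u1 + d1, u2 + d2) - stack u1 u2 - stack d1 d2))\<^sup>2)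
      < csunsal_f1 z + ereal (\<mu> / 2 * (norm (csunsal_G A *v z - stack u1 u2 - stack d1 d2))\<^sup>2)"
    using less assms by simp
qed

text \<open>The objective separates into the two blocks. Their variational inequalities leave a gap
  of at least \<mu>/2 times the squared distance to the claimed minimizer, so it is the only
  one.\<close>

lemma admm_u_step:
  fixes y v1 :: "real^'k" and v2 :: "real^'n"
  assumes "\<mu> > 0" "\<delta> \<ge> 0" "lam \<ge> 0"
  shows "minimizer (\<lambda>w. csunsal_f2 y \<delta> lam w + ereal (\<mu> / 2 * (norm (stack v1 v2 - w))\<^sup>2)) u
    \<longleftrightarrow> u = stack (ball_proj y \<delta> v1) (pos_part (soft v2 (lam / \<mu>)))"
proof (rule minimizer_iff_of_strict)
  define p q where "p = ball_proj y \<delta> v1" and "q = pos_part (soft v2 (lam / \<mu>))"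
  have p: "p \<in> cball y \<delta>" unfolding p_def using assms(2) by (rule ball_proj_in_cball)
  have q: "q \<in> nonneg_orthant" unfolding q_def by (rule pos_part_in_orthant)
  have split: "(norm (stack v1 v2 - w))\<^sup>2 = (norm (v1 - upper w))\<^sup>2 + (norm (v2 - lower w))\<^sup>2" for w
  proof -
    have "stack v1 v2 - w = stack (v1 - upper w) (v2 - lower w)"
      by (metis stack_diff stack_upper_lower)
    then show ?thesis by (simp add: norm_stack)
  qed
  fix w assume w: "w \<noteq> stack (ball_proj y \<delta> v1) (pos_part (soft v2 (lam / \<mu>)))"
  have "csunsal_f2 y \<delta> lam (stack p q) + ereal (\<mu> / 2 * (norm (stack v1 v2 - stack p q))\<^sup>2)
      < csunsal_f2 y \<delta> lam w + ereal (\<mu> / 2 * (norm (stack v1 v2 - w))\<^sup>2)"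
  proof (cases "upper w \<in> cball y \<delta> \<and> lower w \<in> nonneg_orthant")
    case False
    then show ?thesis using p q by (auto simp: csunsal_f2_eq)
  next
    case True
    define a b where "a = upper w" and "b = lower w"
    have "(v1 - p) \<bullet> (a - p) \<le> 0"
      unfolding p_def a_def using assms(2) True by (intro ball_proj_variational) simp_all
    then have 1: "(norm (v1 - p))\<^sup>2 + (norm (a - p))\<^sup>2 \<le> (norm (v1 - a))\<^sup>2"
      by (simp add: power2_norm_eq_inner inner_simps inner_commute)
    have "(v2 - q) \<bullet> (b - q) \<le> lam / \<mu> * (1 \<bullet> (b - q))"
      unfolding q_def b_def using assms True by (intro pos_part_soft_variational) simp_all
    \<comment> \<open>Multiplication by \<mu> turns the threshold \<open>lam / \<mu>\<close> back
      into the weight \<open>lam\<close> of the objective.\<close>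
    then have "\<mu> * ((v2 - q) \<bullet> (b - q)) \<le> \<mu> * (lam / \<mu> * (1 \<bullet> (b - q)))"
      using assms(1) by (intro mult_left_mono) simp_all
    then have 2: "\<mu> * ((v2 - q) \<bullet> (b - q)) \<le> lam * (1 \<bullet> (b - q))" using assms(1) by simp
    have 3: "(norm (v2 - b))\<^sup>2 = (norm (v2 - q))\<^sup>2 + (norm (b - q))\<^sup>2 - 2 * ((v2 - q) \<bullet> (b - q))"
      by (simp add: power2_norm_eq_inner inner_simps inner_commute)
    have "a \<noteq> p \<or> b \<noteq> q" using w by (simp add: stack_eq_iff a_def b_def p_def q_def)
    then have "0 < (norm (a - p))\<^sup>2 + (norm (b - q))\<^sup>2"
      by (simp add: sum_power2_gt_zero_iff)
    then have "0 < \<mu> * ((norm (a - p))\<^sup>2 + (norm (b - q))\<^sup>2)" using assms(1) by simp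
    moreover have "\<mu> * ((norm (v1 - p))\<^sup>2 + (norm (a - p))\<^sup>2) \<le> \<mu> * (norm (v1 - a))\<^sup>2"
      using 1 assms(1) by (intro mult_left_mono) simp_all
    ultimately have "lam * (1 \<bullet> q) + \<mu> / 2 * ((norm (v1 - p))\<^sup>2 + (norm (v2 - q))\<^sup>2)
        < lam * (1 \<bullet> b) + \<mu> / 2 * ((norm (v1 - a))\<^sup>2 + (norm (v2 - b))\<^sup>2)"
      using 2 unfolding 3 by (simp add: inner_diff_right algebra_simps)
    then show ?thesis
      using True p q by (simp add: csunsal_f2_eq split a_def b_def)
  qed
  then show "csunsal_f2 y \<delta> lam (stack (ball_proj y \<delta> v1) (pos_part (soft v2 (lam / \<mu>))))
        + ereal (\<mu> / 2 * (norm (stack v1 v2 - stack (ball_proj y \<delta> v1) (pos_part (soft v2 (lam / \<mu>)))))\<^sup>2)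
      < csunsal_f2 y \<delta> lam w + ereal (\<mu> / 2 * (norm (stack v1 v2 - w))\<^sup>2)"
    by (simp only: p_def q_def)
qed

text \<open>Both subproblems have exactly one minimizer, so choosing a minimizer and applying the
  explicit update are the same condition.\<close>

lemma csunsal_iff_admm:
  fixes A :: "real^'n^'k"
  assumes "\<mu> > 0" "\<delta> \<ge> 0" "lam \<ge> 0"
  shows "csunsal A y \<delta> lam \<mu> x u1 u2 d1 d2 \<longleftrightarrow>
    admm \<mu> csunsal_f1 (csunsal_f2 y \<delta> lam) (csunsal_G A)
      x (\<lambda>j. stack (u1 j) (u2 j)) (\<lambda>j. stack (d1 j) (d2 j))"
proof -
  have u: "csunsal_G A *v z - w - stack a b = stack (A *v z - a) (z - b) - w" for z w a b
  proof -
    have "csunsal_G A *v z - w - stack a b = csunsal_G A *v z - stack a b - w" by simp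
    then show ?thesis by (simp only: csunsal_G_mult stack_diff)
  qed
  have u_step: "minimizer (\<lambda>w. csunsal_f2 y \<delta> lam w + ereal (\<mu> / 2 * (norm (csunsal_G A *v z - w - stack a b))\<^sup>2)) v
      \<longleftrightarrow> v = stack (ball_proj y \<delta> (A *v z - a)) (pos_part (soft (z - b) (lam / \<mu>)))" for z a b v
    unfolding u by (rule admm_u_step[OF assms])
  show ?thesis
    unfolding csunsal_def admm_def admm_x_step[OF assms(1)] u_step
    by (simp add: normal_solve_def csunsal_G_mult stack_diff stack_eq_iff add.assoc)
qed

section \<open>Closedness, properness, convexity, semicontinuity and coercivity\<close>

lemma linear_upper: "linear (upper :: real^('k::finite + 'n::finite) \<Rightarrow> real^'k)"
  and linear_lower: "linear (lower :: real^('k::finite + 'n::finite) \<Rightarrow> real^'n)"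
  by (auto intro!: linearI simp: upper_def lower_def vec_eq_iff)

lemma closed_csunsal_f2:
  fixes y :: "real^'k"
  shows "closed_fun (csunsal_f2 y \<delta> lam :: real^('k + 'n::finite) \<Rightarrow> ereal)"
proof -
  note cont = linear_continuous_on_compose[OF _ linear_upper] linear_continuous_on_compose[OF _ linear_lower]
  have "{(u :: real^('k + 'n), r). csunsal_f2 y \<delta> lam u \<le> ereal r}
      = {s. dist y (upper (fst s)) \<le> \<delta>}
        \<inter> (\<Inter>i. {s. 0 \<le> lower (fst s) $ i}) \<inter> {s. lam * (1 \<bullet> lower (fst s)) \<le> snd s}"
    by (auto simp: csunsal_f2_eq nonneg_orthant_def split: if_splits)
  also have "closed \<dots>"
    by (intro closed_Int closed_INT ballI closed_Collect_le continuous_intros cont)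
  finally show ?thesis by (simp add: closed_fun_def)
qed

lemma proper_cbpdn_objective:
  "\<exists>x. cbpdn_feasible A y \<delta> x \<Longrightarrow> proper_fun (cbpdn_objective A y \<delta>)"
  by (auto simp: proper_fun_def cbpdn_objective_eq)

lemma convex_cbpdn_feasible:
  fixes A :: "real^'n^'k"
  shows "convex {x. cbpdn_feasible A y \<delta> x}"
proof -
  have "{x. cbpdn_feasible A y \<delta> x} = (*v) A -` cball y \<delta> \<inter> nonneg_orthant"
    by (auto simp: cbpdn_feasible_def dist_norm norm_minus_commute)
  then show ?thesis
    by (simp add: convex_Int convex_nonneg_orthant convex_linear_vimage)
qed

lemma closed_cbpdn_feasible:
  fixes A :: "real^'n^'k"
  shows "closed {x. cbpdn_feasible A y \<delta> x}"
proof -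
  have "{x. cbpdn_feasible A y \<delta> x} = {x. norm (A *v x - y) \<le> \<delta>} \<inter> nonneg_orthant"
    by (auto simp: cbpdn_feasible_def)
  also have "closed \<dots>"
    by (intro closed_Int closed_nonneg_orthant closed_Collect_le continuous_intros
        linear_continuous_on_compose[OF _ matrix_vector_mul_linear])
  finally show ?thesis .
qed

lemma convex_cbpdn_objective:
  fixes A :: "real^'n^'k"
  shows "convex_fun (cbpdn_objective A y \<delta>)"
proof -
  \<comment> \<open>On the feasible set the l1 norm is linear, so the epigraph is a cylinder over
    that set cut by the half-space \<open>1 \<bullet> x \<le> r\<close>.\<close>
  have "{(x, r::real). cbpdn_objective A y \<delta> x \<le> ereal r}
      = {x. cbpdn_feasible A y \<delta> x} \<times> UNIV \<inter> {s. (1, -1) \<bullet> s \<le> 0}"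
    by (auto simp: cbpdn_objective_eq inner_prod_def cbpdn_feasible_def l1_norm_orthant split: if_splits)
  also have "convex \<dots>"
    by (intro convex_Int convex_Times convex_cbpdn_feasible convex_UNIV convex_halfspace_le)
  finally show ?thesis by (simp add: convex_fun_def)
qed

lemma continuous_on_l1_norm: "continuous_on S l1_norm"
  unfolding l1_norm_def by (intro continuous_intros)

text \<open>At a feasible point the objective equals the continuous l1 norm, which minorizes it
  everywhere. An infeasible point has a neighbourhood on which the objective is infinite.\<close>

lemma lsc_cbpdn_objective:
  fixes A :: "real^'n^'k"
  shows "lsc_fun (cbpdn_objective A y \<delta>)"
  unfolding lsc_fun_def le_Liminf_iff
proof (intro allI impI)
  fix x C assume C: "C < cbpdn_objective A y \<delta> x"
  show "\<forall>\<^sub>F z in at x. C < cbpdn_objective A y \<delta> z"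
  proof (cases "cbpdn_feasible A y \<delta> x")
    case True
    have "(l1_norm \<longlongrightarrow> l1_norm x) (at x)"
      using continuous_on_l1_norm[of "UNIV :: (real^'n) set"] by (simp add: continuous_on_def)
    then have "((\<lambda>z. ereal (l1_norm z)) \<longlongrightarrow> ereal (l1_norm x)) (at x)" by simp
    moreover have "C < ereal (l1_norm x)" using C True by (simp add: cbpdn_objective_eq)
    ultimately have "\<forall>\<^sub>F z in at x. C < ereal (l1_norm z)" by (rule order_tendstoD(1))
    then show ?thesis
      by eventually_elim (auto simp: cbpdn_objective_eq intro: less_le_trans)
  next
    case False
    then have "\<forall>\<^sub>F z in at x. z \<in> - {x. cbpdn_feasible A y \<delta> x}"
      by (intro eventually_at_in_open' open_Compl closed_cbpdn_feasible) simp
    then show ?thesis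
      by eventually_elim (use C in \<open>auto simp: cbpdn_objective_eq False\<close>)
  qed
qed

lemma coercive_cbpdn_objective:
  fixes A :: "real^'n^'k"
  shows "coercive_fun (cbpdn_objective A y \<delta>)"
  unfolding coercive_fun_def tendsto_PInfty
proof
  fix C :: real
  have "\<forall>\<^sub>F x in at_infinity. C + 1 \<le> norm x"
    by (auto simp: eventually_at_infinity)
  then show "\<forall>\<^sub>F x in at_infinity. ereal C < cbpdn_objective A y \<delta> x"
  proof eventually_elim
    case (elim x)
    then show ?case using norm_le_l1_norm[of x] by (simp add: cbpdn_objective_eq)
  qed
qed

text \<open>Feasibility excludes the constant value infinity, for which every point would be a
  minimizer.\<close>

lemma minimizer_cbpdn_objective_iff:
  assumes "\<exists>x. cbpdn_feasible A y \<delta> x"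
  shows "minimizer (cbpdn_objective A y \<delta>) x \<longleftrightarrow> cbpdn_solution A y \<delta> x"
  using assms by (auto simp: is_arg_min_def cbpdn_solution_def cbpdn_objective_eq split: if_splits)

section \<open>Existence of solutions and convergence of the algorithm\<close>

lemma cbpdn_solutionI:
  assumes "cbpdn_feasible A y \<delta> x" "\<And>z. cbpdn_feasible A y \<delta> z \<Longrightarrow> 1 \<bullet> x \<le> 1 \<bullet> z"
  shows "cbpdn_solution A y \<delta> x"
  using assms by (auto simp: cbpdn_solution_def is_arg_min_def cbpdn_feasible_def l1_norm_orthant not_less)

text \<open>The iteration itself provides a solution: with threshold 1, the shadow of the orbit
  started at 0 converges to one.\<close>

lemma cbpdn_solution_exists:
  fixes A :: "real^'n^'k"
  assumes "\<delta> \<ge> 0" "\<exists>x. cbpdn_feasible A y \<delta> x"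
  shows "\<exists>x. cbpdn_solution A y \<delta> x"
proof -
  interpret dr_orbit A y \<delta> 1 "\<lambda>j. (dr_step A y \<delta> 1 ^^ j) 0"
    using assms by unfold_locales simp_all
  show ?thesis using shadow_limit cbpdn_solutionI by fastforce
qed

lemma csunsal_converges:
  fixes A :: "real^'n^'k"
  assumes "\<mu> > 0" "\<delta> \<ge> 0" "lam \<ge> 0" and feas: "\<exists>x. cbpdn_feasible A y \<delta> x"
    and run: "csunsal A y \<delta> lam \<mu> x u1 u2 d1 d2"
  shows "\<exists>xs. x \<longlonglongrightarrow> xs \<and> cbpdn_feasible A y \<delta> xs
    \<and> (\<forall>z. cbpdn_feasible A y \<delta> z \<longrightarrow> lam * (1 \<bullet> xs) \<le> lam * (1 \<bullet> z))"
proof -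
  define \<tau> where "\<tau> = lam / \<mu>"
  define S where "S j = (A *v x (Suc j) - d1 j, x (Suc j) - d2 j)" for j
  have x: "x (Suc j) = normal_solve A (u1 j + d1 j, u2 j + d2 j)"
    and prox: "prox y \<delta> \<tau> (S j) = (u1 (Suc j), u2 (Suc j))"
    and d: "(d1 (Suc j), d2 (Suc j)) = (u1 (Suc j), u2 (Suc j)) - S j" for j
    using run by (simp_all add: csunsal_def normal_solve_def prox_def S_def \<tau>_def add.assoc)
  \<comment> \<open>The reflected point is exactly the data of the next least-squares update, which
    identifies that update with the graph projection.\<close>
  have reflect: "2 *\<^sub>R prox y \<delta> \<tau> (S j) - S j = (u1 (Suc j) + d1 (Suc j), u2 (Suc j) + d2 (Suc j))" for j
    using d[of j] by (simp add: prox prod_eq_iff scaleR_2)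
  interpret D: dr_orbit A y \<delta> \<tau> S
  proof
    fix j
    have "dr_step A y \<delta> \<tau> (S j) = graph_proj A (2 *\<^sub>R prox y \<delta> \<tau> (S j) - S j) - (d1 (Suc j), d2 (Suc j))"
      unfolding dr_step_def d[of j] prox by simp
    then show "S (Suc j) = dr_step A y \<delta> \<tau> (S j)"
      by (simp only: reflect graph_proj_def x[symmetric]) (simp add: S_def)
  qed (use assms in \<open>simp_all add: \<tau>_def\<close>)
  obtain xs where xs: "D.u2 \<longlonglongrightarrow> xs" "cbpdn_feasible A y \<delta> xs"
    "\<And>z. cbpdn_feasible A y \<delta> z \<Longrightarrow> \<tau> * (1 \<bullet> xs) \<le> \<tau> * (1 \<bullet> z)"
    using D.shadow_limit by blast
  \<comment> \<open>\<open>S j\<close> already contains \<open>x (Suc j)\<close>, so the projection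
    of its reflection is one index further. The limit of the shadow passes to \<open>x\<close>
    because \<open>D.u2 j - D.w j\<close> tends to zero.\<close>
  have "D.w j = x (Suc (Suc j))" for j
    by (simp only: D.w_def reflect x)
  moreover have "(\<lambda>j. D.u2 j - (D.u2 j - D.w j)) \<longlonglongrightarrow> xs - 0"
    by (intro tendsto_diff xs(1) D.u2_minus_w)
  ultimately have "(\<lambda>j. x (Suc (Suc j))) \<longlonglongrightarrow> xs" by simp
  then have "x \<longlonglongrightarrow> xs" by (intro LIMSEQ_imp_Suc[of x] LIMSEQ_imp_Suc[of "\<lambda>j. x (Suc j)"])
  moreover have "lam * (1 \<bullet> xs) \<le> lam * (1 \<bullet> z)" if "cbpdn_feasible A y \<delta> z" for z
    using mult_left_mono[OF xs(3)[OF that], of \<mu>] \<open>\<mu> > 0\<close> by (simp add: \<tau>_def)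
  ultimately show ?thesis using xs(2) by blast
qed

text \<open>For \<open>lam = 0\<close> the composite objective only encodes the constraints, and its
  minimizers are all feasible points. The limit is therefore claimed to minimize the composite
  objective in every case, and to solve the denoising problem when \<open>lam > 0\<close>.
  Feasibility is what makes the objective proper.\<close>

theorem mainTheorem2:
  fixes A :: "real^'n^'k" and y :: "real^'k" and \<delta> lam :: real
  assumes "\<delta> \<ge> 0" and "lam \<ge> 0"
    and feasible: "\<exists>x. cbpdn_feasible A y \<delta> x"
  shows
    "(\<delta> = 0 \<longrightarrow> (\<forall>x. cbpdn_feasible A y \<delta> x \<longleftrightarrow> A *v x = y \<and> x \<in> nonneg_orthant))
   \<and> (\<forall>x. minimizer (cbpdn_objective A y \<delta>) x \<longleftrightarrow> cbpdn_solution A y \<delta> x)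
   \<and> proper_fun (cbpdn_objective A y \<delta>)
   \<and> convex_fun (cbpdn_objective A y \<delta>)
   \<and> lsc_fun (cbpdn_objective A y \<delta>)
   \<and> coercive_fun (cbpdn_objective A y \<delta>)
   \<and> {x. minimizer (cbpdn_objective A y \<delta>) x} \<noteq> {}
   \<and> closed_fun (csunsal_f1 :: real^'n \<Rightarrow> ereal)
   \<and> closed_fun (csunsal_f2 y \<delta> lam :: real^('k + 'n) \<Rightarrow> ereal)
   \<and> rank (csunsal_G A) = CARD('n)
   \<and> (\<forall>\<mu> x u1 u2 d1 d2. \<mu> > 0 \<longrightarrow>
        (csunsal A y \<delta> lam \<mu> x u1 u2 d1 d2 \<longleftrightarrow>
         admm \<mu> csunsal_f1 (csunsal_f2 y \<delta> lam) (csunsal_G A)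
           x (\<lambda>j. stack (u1 j) (u2 j)) (\<lambda>j. stack (d1 j) (d2 j))))
   \<and> (\<forall>\<mu> x u1 u2 d1 d2. \<mu> > 0 \<longrightarrow> csunsal A y \<delta> lam \<mu> x u1 u2 d1 d2 \<longrightarrow>
        (\<exists>xs. x \<longlonglongrightarrow> xs
            \<and> minimizer (\<lambda>z. csunsal_f1 z + csunsal_f2 y \<delta> lam (csunsal_G A *v z)) xs
            \<and> (lam > 0 \<longrightarrow> cbpdn_solution A y \<delta> xs)))"
proof (intro conjI allI impI)
  fix x assume "\<delta> = 0"
  then show "cbpdn_feasible A y \<delta> x \<longleftrightarrow> A *v x = y \<and> x \<in> nonneg_orthant"
    by (simp add: cbpdn_feasible_def)
next
  fix x show "minimizer (cbpdn_objective A y \<delta>) x \<longleftrightarrow> cbpdn_solution A y \<delta> x"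
    using feasible by (rule minimizer_cbpdn_objective_iff)
next
  show "{x. minimizer (cbpdn_objective A y \<delta>) x} \<noteq> {}"
    using cbpdn_solution_exists[OF assms(1) feasible] by (simp add: minimizer_cbpdn_objective_iff[OF feasible])
next
  have "{(x :: real^'n, r). csunsal_f1 x \<le> ereal r} = UNIV \<times> {0..}"
    by (auto simp: csunsal_f1_def)
  then show "closed_fun (csunsal_f1 :: real^'n \<Rightarrow> ereal)"
    by (simp add: closed_fun_def closed_Times)
next
  have "inj ((*v) (csunsal_G A))"
    by (rule injI) (metis csunsal_G_mult lower_stack)
  then show "rank (csunsal_G A) = CARD('n)" by (simp add: full_rank_injective)
next
  fix \<mu> :: real and x u1 u2 d1 d2
  assume "\<mu> > 0" "csunsal A y \<delta> lam \<mu> x u1 u2 d1 d2"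
  then obtain xs where xs: "x \<longlonglongrightarrow> xs" "cbpdn_feasible A y \<delta> xs"
    "\<And>z. cbpdn_feasible A y \<delta> z \<Longrightarrow> lam * (1 \<bullet> xs) \<le> lam * (1 \<bullet> z)"
    using csunsal_converges[OF _ assms(1,2) feasible] by blast
  have value_eq: "csunsal_f1 z + csunsal_f2 y \<delta> lam (csunsal_G A *v z)
      = (if cbpdn_feasible A y \<delta> z then ereal (lam * (1 \<bullet> z)) else \<infinity>)" for z
    by (simp add: csunsal_f1_def csunsal_f2_eq csunsal_G_mult cbpdn_feasible_def dist_norm norm_minus_commute)
  have "minimizer (\<lambda>z. csunsal_f1 z + csunsal_f2 y \<delta> lam (csunsal_G A *v z)) xs"
    unfolding value_eq is_arg_min_def using xs(2,3) by (auto simp: not_less)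
  moreover have "cbpdn_solution A y \<delta> xs" if "lam > 0"
    using xs(2,3) that by (intro cbpdn_solutionI) simp_all
  ultimately show "\<exists>xs. x \<longlonglongrightarrow> xs
      \<and> minimizer (\<lambda>z. csunsal_f1 z + csunsal_f2 y \<delta> lam (csunsal_G A *v z)) xs
      \<and> (lam > 0 \<longrightarrow> cbpdn_solution A y \<delta> xs)"
    using xs(1) by blast
qed (use assms in \<open>simp_all only: proper_cbpdn_objective convex_cbpdn_objective lsc_cbpdn_objective
      coercive_cbpdn_objective closed_csunsal_f2 csunsal_iff_admm\<close>)

end
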